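(* Let $\mathcal{C}$ be a finite prevariety over a finite alphabet $A$ with canonical $\mathcal{C}$-morphism $\eta_{\mathcal{C}}:A^*\to N_{\mathcal{C}}$, and let $\rho:2^{A^*}\to R$ be a nice multiplicative rating map. Then the set $\mathcal{P}=\{(t,r)\in N_{\mathcal{C}}\times R \mid r\in \mathcal{I}_{\mathit{SF}(\mathcal{C})}[\eta_{\mathcal{C}}^{-1}(t),\rho]\}$ is the least subset of $N_{\mathcal{C}}\times R$ that is $\mathit{SF}$-saturated for $\eta_{\mathcal{C}}$ and $\rho$.
   Context: Fix a finite alphabet $A$. A lattice is a class of languages containing $\emptyset,A^*$ and closed under union and intersection. A prevariety is a lattice of regular languages closed under complement and under quotients $u^{-1}L=\{w\mid uw\in L\}$, $Lu^{-1}=\{w\mid wu\in L\}$. $\mathit{SF}(\mathcal{C})$ is the least class containing $\mathcal{C}$ and all $\{a\}$ ($a\in A$), closed under union, complement and concatenation. A $\mathcal{C}$-morphism is a surjective monoid morphism $\eta:A^*\to N$ onto a finite monoid such that every language $\eta^{-1}(F)$, $F\subseteq N$, belongs to $\mathcal{C}$. When $\mathcal{C}$ is a finite prevariety, there is a $\mathcal{C}$-morphism $\eta_{\mathcal{C}}:A^*\to N_{\mathcal{C}}$ recognizing every language of $\mathcal{C}$, unique up to isomorphism: the canonical $\mathcal{C}$-morphism. A rating algebra is a finite commutative idempotent monoid $(R,+)$ with neutral element $0_R$, ordered by $r\le s$ iff $r+s=s$. A rating map is a map $\rho:2^{A^*}\to R$ with $\rho(\emptyset)=0_R$ and $\rho(K_1\cup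 K_2)=\rho(K_1)+\rho(K_2)$. It is nice if for every $K\subseteq A^*$ there is a finite $F\subseteq K$ with $\rho(K)=\rho(F)$. It is multiplicative if $R$ carries a multiplication making $(R,+,\cdot)$ an idempotent semiring (with $0_R$ absorbing and multiplication distributing over $+$) and $\rho(\{\varepsilon\})=1_R$, $\rho(K_1K_2)=\rho(K_1)\rho(K_2)$. Write $\rho(w)$ for $\rho(\{w\})$. For $r\in R$, $\omega$ is a positive integer such that $r^\omega$ is multiplicatively idempotent for all $r\in R$. A cover of $L$ is a finite set $\mathbf{K}$ of languages with $L\subseteq\bigcup\mathbf{K}$; it is a $\mathcal{D}$-cover if all members are in $\mathcal{D}$. Its $\rho$-imprint is $\{r\in R\mid \exists K\in\mathbf{K},\ r\le\rho(K)\}$. For a lattice $\mathcal{D}$ there exists a $\mathcal{D}$-cover of $L$ whose $\rho$-imprint is included in the $\rho$-imprint of every $\mathcal{D}$-cover of $L$; this imprint is denoted $\mathcal{I}_{\mathcal{D}}[L,\rho]$. For a morphism $\eta:A^*\to N$ into a finite monoid and a multiplicative rating map $\rho:2^{A^*}\to R$, a set $S\subseteq N\times R$ is $\mathit{SF}$-saturated for $\eta$ and $\rho$ if: (1) $(\eta(w),\rho(w))\in S$ for every $w\in A^*$; (2) if $(t,r)\in S$ and $q\le r$ then $(t,q)\in S$; (3) if $(s,q),(t,r)\in S$ then $(st,qr)\in S$; (4) if $(e,r)\in S$ and $e$ is idempotent in $N$, then $(e,r^\omega+r^{\omega+1})\in S$. *)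

theory Defs
  imports Main
begin

text \<open>Alphabet: a finite type 'a (A = UNIV). Words: 'a list. Languages: 'a list set.\<close>

definition conc :: "'a list set \<Rightarrow> 'a list set \<Rightarrow> 'a list set" where
  "conc K L = {u @ v | u v. u \<in> K \<and> v \<in> L}"

inductive_set star :: "'a list set \<Rightarrow> 'a list set" for L where
  star_nil: "[] \<in> star L"
| star_app: "u \<in> L \<Longrightarrow> v \<in> star L \<Longrightarrow> u @ v \<in> star L"

inductive_set regular :: "'a list set set" where
  reg_empty: "{} \<in> regular"
| reg_eps: "{[]} \<in> regular"
| reg_letter: "{[a]} \<in> regular"
| reg_union: "K \<in> regular \<Longrightarrow> L \<in> regular \<Longrightarrow> K \<union> L \<in> regular"
| reg_conc: "K \<in> regular \<Longrightarrow> L \<in> regular \<Longrightarrow> conc K L \<in> regular"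
| reg_star: "L \<in> regular \<Longrightarrow> star L \<in> regular"

definition lattice :: "'a list set set \<Rightarrow> bool" where
  "lattice D \<longleftrightarrow> {} \<in> D \<and> UNIV \<in> D \<and>
     (\<forall>K\<in>D. \<forall>L\<in>D. K \<union> L \<in> D \<and> K \<inter> L \<in> D)"

definition prevariety :: "'a list set set \<Rightarrow> bool" where
  "prevariety C \<longleftrightarrow> lattice C \<and> C \<subseteq> regular \<and>
     (\<forall>L\<in>C. - L \<in> C) \<and>
     (\<forall>L\<in>C. \<forall>u. {w. u @ w \<in> L} \<in> C \<and> {w. w @ u \<in> L} \<in> C)"

inductive_set SF :: "'a list set set \<Rightarrow> 'a list set set" for C where
  SF_base: "L \<in> C \<Longrightarrow> L \<in> SF C"
| SF_letter: "{[a]} \<in> SF C"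
| SF_union: "K \<in> SF C \<Longrightarrow> L \<in> SF C \<Longrightarrow> K \<union> L \<in> SF C"
| SF_compl: "L \<in> SF C \<Longrightarrow> - L \<in> SF C"
| SF_conc: "K \<in> SF C \<Longrightarrow> L \<in> SF C \<Longrightarrow> conc K L \<in> SF C"

definition monoid_morphism :: "('a list \<Rightarrow> 'n::monoid_mult) \<Rightarrow> bool" where
  "monoid_morphism \<eta> \<longleftrightarrow> \<eta> [] = 1 \<and> (\<forall>u v. \<eta> (u @ v) = \<eta> u * \<eta> v)"

definition C_morphism :: "'a list set set \<Rightarrow> ('a list \<Rightarrow> 'n::{monoid_mult,finite}) \<Rightarrow> bool" where
  "C_morphism C \<eta> \<longleftrightarrow> surj \<eta> \<and> monoid_morphism \<eta> \<and> (\<forall>F. \<eta> -` F \<in> C)"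

text \<open>Canonical C-morphism: a C-morphism recognizing every language of C
  (unique up to isomorphism).\<close>
definition canonical_C_morphism :: "'a list set set \<Rightarrow> ('a list \<Rightarrow> 'n::{monoid_mult,finite}) \<Rightarrow> bool" where
  "canonical_C_morphism C \<eta> \<longleftrightarrow> C_morphism C \<eta> \<and> (\<forall>L\<in>C. \<exists>F. L = \<eta> -` F)"

definition rle :: "'r::plus \<Rightarrow> 'r \<Rightarrow> bool" where
  "rle r s \<longleftrightarrow> r + s = s"

text \<open>Rating maps into a finite idempotent semiring ('r with class semiring_0 and monoid_mult:
  commutative additive monoid with 0, associative multiplication with unit 1,
  distributivity, 0 absorbing); additive idempotency is required explicitly.\<close>
definition rating_map :: "('a list set \<Rightarrow> 'r::{comm_monoid_add,finite}) \<Rightarrow> bool" where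
  "rating_map \<rho> \<longleftrightarrow> (\<forall>r::'r. r + r = r) \<and> \<rho> {} = 0 \<and>
     (\<forall>K1 K2. \<rho> (K1 \<union> K2) = \<rho> K1 + \<rho> K2)"

definition nice :: "('a list set \<Rightarrow> 'r::{comm_monoid_add,finite}) \<Rightarrow> bool" where
  "nice \<rho> \<longleftrightarrow> (\<forall>K. \<exists>F. finite F \<and> F \<subseteq> K \<and> \<rho> K = \<rho> F)"

definition multiplicative_rating_map ::
  "('a list set \<Rightarrow> 'r::{semiring_0,monoid_mult,finite}) \<Rightarrow> bool" where
  "multiplicative_rating_map \<rho> \<longleftrightarrow> rating_map \<rho> \<and> \<rho> {[]} = 1 \<and>
     (\<forall>K1 K2. \<rho> (conc K1 K2) = \<rho> K1 * \<rho> K2)"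

definition is_cover :: "'a list set \<Rightarrow> 'a list set set \<Rightarrow> bool" where
  "is_cover L KK \<longleftrightarrow> finite KK \<and> L \<subseteq> \<Union> KK"

definition is_D_cover :: "'a list set set \<Rightarrow> 'a list set \<Rightarrow> 'a list set set \<Rightarrow> bool" where
  "is_D_cover D L KK \<longleftrightarrow> is_cover L KK \<and> KK \<subseteq> D"

definition imprint :: "('a list set \<Rightarrow> 'r::plus) \<Rightarrow> 'a list set set \<Rightarrow> 'r set" where
  "imprint \<rho> KK = {r. \<exists>K\<in>KK. rle r (\<rho> K)}"

text \<open>I_D[L,rho]: the imprint of a D-cover of L whose imprint is included in the imprint
  of every D-cover of L (exists for lattices D).\<close>
definition opt_imprint :: "'a list set set \<Rightarrow> 'a list set \<Rightarrow> ('a list set \<Rightarrow> 'r::plus) \<Rightarrow> 'r set" where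
  "opt_imprint D L \<rho> = imprint \<rho> (SOME KK. is_D_cover D L KK \<and>
      (\<forall>KK'. is_D_cover D L KK' \<longrightarrow> imprint \<rho> KK \<subseteq> imprint \<rho> KK'))"

text \<open>SF-saturation, with \<omega> a fixed positive integer making every r^\<omega> idempotent.\<close>
definition SF_saturated :: "('a list \<Rightarrow> 'n::monoid_mult) \<Rightarrow> ('a list set \<Rightarrow> 'r::{semiring_0,monoid_mult})
    \<Rightarrow> nat \<Rightarrow> ('n \<times> 'r) set \<Rightarrow> bool" where
  "SF_saturated \<eta> \<rho> \<omega> S \<longleftrightarrow>
     (\<forall>w. (\<eta> w, \<rho> {w}) \<in> S) \<and>
     (\<forall>t r q. (t, r) \<in> S \<and> rle q r \<longrightarrow> (t, q) \<in> S) \<and>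
     (\<forall>s q t r. (s, q) \<in> S \<and> (t, r) \<in> S \<longrightarrow> (s * t, q * r) \<in> S) \<and>
     (\<forall>e r. (e, r) \<in> S \<and> e * e = e \<longrightarrow> (e, r ^ \<omega> + r ^ (\<omega> + 1)) \<in> S)"

definition least_SF_saturated :: "('a list \<Rightarrow> 'n::monoid_mult) \<Rightarrow> ('a list set \<Rightarrow> 'r::{semiring_0,monoid_mult})
    \<Rightarrow> nat \<Rightarrow> ('n \<times> 'r) set \<Rightarrow> bool" where
  "least_SF_saturated \<eta> \<rho> \<omega> P \<longleftrightarrow>
     SF_saturated \<eta> \<rho> \<omega> P \<and> (\<forall>S. SF_saturated \<eta> \<rho> \<omega> S \<longrightarrow> P \<subseteq> S)"

end

theory Submission
  imports Defs
begin

text \<open>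
  Saturation of the optimal imprints: a finite family of languages of \<open>SF C\<close> has a syntactic
  congruence of finite index whose classes are again in \<open>SF C\<close>, so that optimal imprints can be
  tested on classes. Classes multiply, and \<open>w\<^sup>n\<close> and \<open>w\<^sup>n\<^sup>+\<^sup>1\<close> are congruent for large \<open>n\<close> as soon
  as \<open>\<eta> w\<close> is idempotent.

  Minimality: let \<open>W B\<close> be the closure of a set \<open>B\<close> of weights in \<open>N \<times> R\<close> under products and the
  operation \<open>(e, r) \<mapsto> (e, r\<^sup>\<omega> + r\<^sup>\<omega>\<^sup>+\<^sup>1)\<close>
    for idempotent \<open>e\<close>. Weights serve as letters, and every word
  over \<open>B\<close> is labelled
    by an element of \<open>W B\<close> that dominates its product when acting from the right
  on a set \<open>X\<close>, in such a way that all fibres are star-free over the action on first components.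
  The labelling is obtained
    by induction on \<open>(|X|, |B|)\<close>, in the spirit of local divisors. If all
  letters permute \<open>X\<close>, the label only depends on the action on first components: the elements
  \<open>(e, r\<^sup>\<omega> + r\<^sup>\<omega>\<^sup>+\<^sup>1)\<close> act like \<open>1 + r\<close>, and a product of such elements dominates finitely many weights
  simultaneously. If some letter \<open>c\<close> does not, words are cut at the occurrences of \<open>c\<close>; the
  factors in between are words over \<open>B - {c}\<close>, and their labels, multiplied
    by \<open>c\<close>, form a new
  alphabet acting on the smaller set \<open>X * c\<close>.
\<close>

section \<open>Closure properties of star-free closure\<close>

lemma concI: "u \<in> K \<Longrightarrow> v \<in> L \<Longrightarrow> u @ v \<in> conc K L"
  unfolding conc_def by blast

lemma concE:
  assumes "w \<in> conc K L"
  obtains u v where "w = u @ v" "u \<in> K" "v \<in> L"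
  using assms unfolding conc_def by blast

lemma SF_inter:
  assumes "K \<in> SF C" "L \<in> SF C"
  shows "K \<inter> L \<in> SF C"
proof -
  have "K \<inter> L = - (- K \<union> - L)" by blast
  then show ?thesis using assms by (metis SF_union SF_compl)
qed

lemma SF_Union:
  assumes "{} \<in> C" "finite F" "F \<subseteq> SF C"
  shows "\<Union>F \<in> SF C"
  using assms(2,3)
proof (induction F)
  case empty
  then show ?case using SF_base[OF assms(1)] by simp
next
  case (insert K F)
  then show ?case by (simp add: SF_union)
qed

lemma SF_UN:
  assumes "{} \<in> C" "finite I" "\<And>i. i \<in> I \<Longrightarrow> f i \<in> SF C"
  shows "(\<Union>i\<in>I. f i) \<in> SF C"
  using SF_Union[OF assms(1), of "f ` I"] assms(2,3) by blast

lemma SF_UNIV: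
  assumes "{} \<in> C"
  shows "UNIV \<in> SF C"
  using SF_compl[OF SF_base[OF assms]] by simp

lemma SF_INT:
  assumes "{} \<in> C" "finite I" "\<And>i. i \<in> I \<Longrightarrow> f i \<in> SF C"
  shows "(\<Inter>i\<in>I. f i) \<in> SF C"
proof -
  have "(\<Inter>i\<in>I. f i) = - (\<Union>i\<in>I. - f i)" by blast
  then show ?thesis using SF_UN[OF assms(1,2), of "\<lambda>i. - f i"] assms(3) by (metis SF_compl)
qed

text \<open>A word lies in \<open>lists B\<close> iff it has no factor consisting of one letter
  outside \<open>B\<close>. The alphabet is finite, so this excludes finitely many star-free
  languages.\<close>

lemma SF_lists:
  fixes C :: "'a::finite list set set"
  assumes "{} \<in> C"
  shows "lists B \<in> SF C"
proof -
  have "lists B = - (\<Union>b\<in>-B. conc UNIV (conc {[b]} UNIV))"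
  proof (intro set_eqI)
    fix w :: "'a list"
    have "w \<in> conc UNIV (conc {[b]} UNIV) \<longleftrightarrow> b \<in> set w" for b
      by (auto simp: conc_def in_set_conv_decomp)
    then show "w \<in> lists B \<longleftrightarrow> w \<in> - (\<Union>b\<in>-B. conc UNIV (conc {[b]} UNIV))"
      by (auto simp: lists_eq_set)
  qed
  moreover have "(\<Union>b\<in>-B. conc UNIV (conc {[b]} UNIV)) \<in> SF C"
    by (intro SF_UN SF_conc SF_letter SF_UNIV assms) auto
  ultimately show ?thesis by (metis SF_compl)
qed

lemma SF_eps:
  fixes C :: "'a::finite list set set"
  assumes "{} \<in> C"
  shows "{[]} \<in> SF C"
  using SF_lists[OF assms, of "{}"] by (simp add: lists_empty)

section \<open>Quotients of languages in the star-free closure\<close>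

definition lquot :: "'a list \<Rightarrow> 'a list set \<Rightarrow> 'a list set" where
  "lquot u L = {w. u @ w \<in> L}"

definition rquot :: "'a list \<Rightarrow> 'a list set \<Rightarrow> 'a list set" where
  "rquot u L = {w. w @ u \<in> L}"

text \<open>Induction on \<open>SF\<close>, as for derivatives of regular expressions: in a
  concatenation the letter is removed from the left factor, or from the right one if the left factor
  may be empty.\<close>

lemma SF_lquot_letter:
  fixes C :: "'a::finite list set set"
  assumes "{} \<in> C" and quot: "\<And>L u. L \<in> C \<Longrightarrow> lquot u L \<in> C"
    and "L \<in> SF C"
  shows "lquot [a] L \<in> SF C"
  using assms(3)
proof induction
  case (SF_base L)
  then show ?case using quot SF.SF_base by blast
next
  case (SF_letter b)
  have "lquot [a] {[b]} = (if a = b then {[]} else {})"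
    by (auto simp: lquot_def)
  then show ?case using SF_eps[OF assms(1)] SF.SF_base[OF assms(1)] by simp
next
  case (SF_union K L)
  have "lquot [a] (K \<union> L) = lquot [a] K \<union> lquot [a] L" by (auto simp: lquot_def)
  then show ?case using SF_union SF.SF_union by metis
next
  case (SF_compl L)
  have "lquot [a] (- L) = - lquot [a] L" by (auto simp: lquot_def)
  then show ?case using SF_compl SF.SF_compl by metis
next
  case (SF_conc K L)
  have "lquot [a] (conc K L) = conc (lquot [a] K) L \<union> (if [] \<in> K then lquot [a] L else {})"
    by (auto simp: lquot_def conc_def Cons_eq_append_conv)
  then show ?case
    using SF.SF_base[OF assms(1)] by (auto intro!: SF.SF_union SF.SF_conc SF_conc)
qed

lemma SF_rquot_letter:
  fixes C :: "'a::finite list set set"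
  assumes "{} \<in> C" and quot: "\<And>L u. L \<in> C \<Longrightarrow> rquot u L \<in> C"
    and "L \<in> SF C"
  shows "rquot [a] L \<in> SF C"
  using assms(3)
proof induction
  case (SF_base L)
  then show ?case using quot SF.SF_base by blast
next
  case (SF_letter b)
  have "rquot [a] {[b]} = (if a = b then {[]} else {})"
    by (auto simp: rquot_def)
  then show ?case using SF_eps[OF assms(1)] SF.SF_base[OF assms(1)] by simp
next
  case (SF_union K L)
  have "rquot [a] (K \<union> L) = rquot [a] K \<union> rquot [a] L" by (auto simp: rquot_def)
  then show ?case using SF_union SF.SF_union by metis
next
  case (SF_compl L)
  have "rquot [a] (- L) = - rquot [a] L" by (auto simp: rquot_def)
  then show ?case using SF_compl SF.SF_compl by metis
next
  case (SF_conc K L)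
  have "rquot [a] (conc K L) = conc K (rquot [a] L) \<union> (if [] \<in> L then rquot [a] K else {})"
  proof (intro set_eqI iffI)
    fix w assume "w \<in> rquot [a] (conc K L)"
    then obtain u v where uv: "w @ [a] = u @ v" "u \<in> K" "v \<in> L"
      by (auto simp: rquot_def conc_def)
    show "w \<in> conc K (rquot [a] L) \<union> (if [] \<in> L then rquot [a] K else {})"
    proof (cases v rule: rev_cases)
      case Nil
      then show ?thesis using uv by (auto simp: rquot_def)
    next
      case (snoc v' b)
      then show ?thesis using uv by (auto simp: rquot_def conc_def)
    qed
  next
    fix w assume "w \<in> conc K (rquot [a] L) \<union> (if [] \<in> L then rquot [a] K else {})"
    then show "w \<in> rquot [a] (conc K L)"
      by (auto simp: rquot_def conc_def split: if_splits) (metis append_Nil2 append.assoc)+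
  qed
  then show ?case
    using SF.SF_base[OF assms(1)] by (auto intro!: SF.SF_union SF.SF_conc SF_conc)
qed

lemma SF_lquot:
  fixes C :: "'a::finite list set set"
  assumes "{} \<in> C" and "\<And>L u. L \<in> C \<Longrightarrow> lquot u L \<in> C"
    and "L \<in> SF C"
  shows "lquot u L \<in> SF C"
  using assms(3)
proof (induction u arbitrary: L)
  case Nil
  then show ?case by (simp add: lquot_def)
next
  case (Cons a u)
  have "lquot (a # u) L = lquot u (lquot [a] L)" by (auto simp: lquot_def)
  then show ?case using Cons SF_lquot_letter[OF assms(1,2)] by metis
qed

lemma SF_rquot:
  fixes C :: "'a::finite list set set"
  assumes "{} \<in> C" and "\<And>L u. L \<in> C \<Longrightarrow> rquot u L \<in> C"
    and "L \<in> SF C"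
  shows "rquot u L \<in> SF C"
  using assms(3)
proof (induction u arbitrary: L rule: rev_induct)
  case Nil
  then show ?case by (simp add: rquot_def)
next
  case (snoc a u)
  have "rquot (u @ [a]) L = rquot u (rquot [a] L)" by (auto simp: rquot_def)
  then show ?case using snoc SF_rquot_letter[OF assms(1,2)] by metis
qed

text \<open>Each operation computes a quotient from finitely many possible data, so finiteness
  passes from \<open>C\<close> to \<open>SF C\<close>.\<close>

lemma finite_lquots_SF:
  fixes C :: "'a::finite list set set"
  assumes fin: "\<And>L. L \<in> C \<Longrightarrow> finite (range (\<lambda>u. lquot u L))"
    and "L \<in> SF C"
  shows "finite (range (\<lambda>u. lquot u L))"
  using assms(2)
proof induction
  case (SF_base L)
  then show ?case using fin by blast
next
  case (SF_letter b)
  have "lquot u {[b]} \<in> {{}, {[]}, {[b]}}" for u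
    by (cases u) (auto simp: lquot_def)
  then have "range (\<lambda>u. lquot u {[b]}) \<subseteq> {{}, {[]}, {[b]}}" by blast
  then show ?case by (rule finite_subset) simp
next
  case (SF_union K L)
  have "range (\<lambda>u. lquot u (K \<union> L)) \<subseteq>
      (\<lambda>(P, Q). P \<union> Q) ` (range (\<lambda>u. lquot u K) \<times> range (\<lambda>u. lquot u L))"
  proof (intro image_subsetI)
    fix u
    have "lquot u (K \<union> L) = (\<lambda>(P, Q). P \<union> Q) (lquot u K, lquot u L)"
      by (auto simp: lquot_def)
    then show "lquot u (K \<union> L) \<in>
      (\<lambda>(P, Q). P \<union> Q) ` (range (\<lambda>u. lquot u K) \<times> range (\<lambda>u. lquot u L))"
      by (rule image_eqI) simp
  qed
  then show ?case using SF_union.IH by (meson finite_SigmaI finite_imageI finite_subset)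
next
  case (SF_compl L)
  have "range (\<lambda>u. lquot u (- L)) \<subseteq> uminus ` range (\<lambda>u. lquot u L)"
  proof (intro image_subsetI)
    fix u
    have "lquot u (- L) = - lquot u L" by (auto simp: lquot_def)
    then show "lquot u (- L) \<in> uminus ` range (\<lambda>u. lquot u L)" by blast
  qed
  then show ?case using SF_compl.IH by (meson finite_imageI finite_subset)
next
  case (SF_conc K L)
  \<comment> \<open>The word \<open>u\<close> may end inside the left factor, leaving a quotient of
    \<open>K\<close>, or be cut as \<open>u1 @ u2\<close> with \<open>u1\<close> in
    \<open>K\<close>, leaving a quotient of \<open>L\<close>. Only the set of quotients of
    \<open>L\<close> arising from such cuts matters.\<close>
  let ?Q = "\<lambda>u. {lquot u2 L | u1 u2. u = u1 @ u2 \<and> u1 \<in> K}"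
  have eq: "lquot u (conc K L) = (\<lambda>(P, Q). conc P L \<union> \<Union>Q) (lquot u K, ?Q u)"
    for u
  proof (intro set_eqI iffI)
    fix w assume "w \<in> lquot u (conc K L)"
    then obtain p q where pq: "u @ w = p @ q" "p \<in> K" "q \<in> L"
      by (auto simp: lquot_def conc_def)
    then consider us where "u = p @ us" "us @ w = q" | us where "u @ us = p" "w = us @ q"
      by (auto simp: append_eq_append_conv2)
    then show "w \<in> (\<lambda>(P, Q). conc P L \<union> \<Union>Q) (lquot u K, ?Q u)"
    proof cases
      case 1
      then have "w \<in> lquot us L" "lquot us L \<in> ?Q u" using pq by (auto simp: lquot_def)
      then show ?thesis by auto
    next
      case 2
      then show ?thesis using pq by (auto simp: lquot_def conc_def)
    qed
  next
    fix w assume "w \<in> (\<lambda>(P, Q). conc P L \<union> \<Union>Q) (lquot u K, ?Q u)"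
    then consider p q where "u @ p \<in> K" "q \<in> L" "w = p @ q"
      | u1 u2 where "u = u1 @ u2" "u1 \<in> K" "u2 @ w \<in> L"
      by (auto simp: lquot_def conc_def)
    then show "w \<in> lquot u (conc K L)"
    proof cases
      case (1 p q)
      then have "u @ w = (u @ p) @ q" by simp
      then show ?thesis using 1 unfolding lquot_def conc_def by blast
    next
      case 2
      then show ?thesis by (auto simp: lquot_def conc_def)
    qed
  qed
  have "range (\<lambda>u. lquot u (conc K L)) \<subseteq>
      (\<lambda>(P, Q). conc P L \<union> \<Union>Q) ` (range (\<lambda>u. lquot u K) \<times> Pow (range (\<lambda>u. lquot u L)))"
  proof (intro image_subsetI)
    fix u
    show "lquot u (conc K L) \<in> (\<lambda>(P, Q). conc P L \<union> \<Union>Q) `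
        (range (\<lambda>u. lquot u K) \<times> Pow (range (\<lambda>u. lquot u L)))"
      by (subst eq, rule imageI) blast
  qed
  then show ?case using SF_conc.IH
    by (meson finite_Pow_iff finite_SigmaI finite_imageI finite_subset)
qed

text \<open>Since \<open>u\<close> lies in \<open>rquot v L\<close> iff \<open>v\<close> lies in
  \<open>lquot u L\<close>, a right quotient is a union of Nerode classes, and there are finitely
  many of these.\<close>

lemma finite_rquots:
  assumes "finite (range (\<lambda>u. lquot u L))"
  shows "finite (range (\<lambda>v. rquot v L))"
proof -
  have eq: "rquot v L = {u. lquot u L \<in> {Q \<in> range (\<lambda>u. lquot u L). v \<in> Q}}"
    for v
    by (auto simp: rquot_def lquot_def)
  have "range (\<lambda>v. rquot v L) \<subseteq> (\<lambda>F. {u. lquot u L \<in> F}) ` Pow (range (\<lambda>u. lquot u L))"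
  proof (intro image_subsetI)
    fix v
    show "rquot v L \<in> (\<lambda>F. {u. lquot u L \<in> F}) ` Pow (range (\<lambda>u. lquot u L))"
      by (subst eq, rule imageI) blast
  qed
  then show ?thesis using assms by (meson finite_Pow_iff finite_imageI finite_subset)
qed

section \<open>Words with idempotent image are eventually periodic with period one\<close>

definition wpow :: "'a list \<Rightarrow> nat \<Rightarrow> 'a list" where
  "wpow w n = concat (replicate n w)"

lemma wpow_0 [simp]: "wpow w 0 = []"
  by (simp add: wpow_def)

lemma wpow_Suc: "wpow w (Suc n) = w @ wpow w n"
  by (simp add: wpow_def)

lemma wpow_add: "wpow w (m + n) = wpow w m @ wpow w n"
  by (simp add: wpow_def replicate_add)

lemma wpow_Nil [simp]: "wpow [] n = []"
  by (simp add: wpow_def)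

lemma length_wpow: "length (wpow w n) = n * length w"
  by (induction n) (auto simp: wpow_Suc)

text \<open>Aperiodicity of \<open>L\<close> relative to one word \<open>w\<close>: languages of
  \<open>C\<close> may count, so it cannot be asked of every word.\<close>

definition stable_at :: "'a list \<Rightarrow> 'a list set \<Rightarrow> nat \<Rightarrow> bool" where
  "stable_at w L k \<longleftrightarrow> (\<forall>x y. x @ wpow w k @ y \<in> L \<longleftrightarrow> x @ wpow w (Suc k) @ y \<in> L)"

lemma stable_at_mono:
  assumes "stable_at w L k" "k \<le> n"
  shows "stable_at w L n"
proof -
  from assms(2) obtain d where "n = d + k" by (metis le_iff_add add.commute)
  then have "x @ wpow w n @ y = (x @ wpow w d) @ wpow w k @ y"
    "x @ wpow w (Suc n) @ y = (x @ wpow w d) @ wpow w (Suc k) @ y" for x y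
    by (simp_all add: wpow_add flip: add_Suc_right)
  then show ?thesis using assms(1) unfolding stable_at_def by metis
qed

text \<open>The cut falls either after the first \<open>a\<close> copies of \<open>w\<close>, or
  before their end, in which case the remaining \<open>n - a >= b\<close> copies are all on its
  right.\<close>

lemma wpow_split:
  assumes "u @ v = x @ wpow w n @ y" "a + b \<le> n"
  shows "(\<exists>y'. u = x @ wpow w a @ y' \<and> y' @ v = wpow w (n - a) @ y) \<or>
         (\<exists>x'. v = x' @ wpow w b @ y \<and> u @ x' = x @ wpow w (n - b))"
proof -
  have 1: "x @ wpow w n @ y = (x @ wpow w a) @ (wpow w (n - a) @ y)"
    using assms(2) wpow_add[of w a "n - a"] by simp
  have suffix: "wpow w (n - a) = wpow w (n - a - b) @ wpow w b"
    using assms(2) wpow_add[of w "n - a - b" b] by simp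
  have prefix: "wpow w (n - b) = wpow w a @ wpow w (n - a - b)"
    using assms(2) wpow_add[of w "a" "n - a - b"] by simp
  from assms(1)[unfolded 1]
  consider us where "u = (x @ wpow w a) @ us" "us @ v = wpow w (n - a) @ y"
    | us where "u @ us = x @ wpow w a" "v = us @ wpow w (n - a) @ y"
    unfolding append_eq_append_conv2[of u] by blast
  then show ?thesis
  proof cases
    case 1
    then show ?thesis by auto
  next
    case (2 us)
    have "v = (us @ wpow w (n - a - b)) @ wpow w b @ y"
      unfolding 2(2) suffix by simp
    moreover have "u @ us @ wpow w (n - a - b) = x @ wpow w (n - b)"
      unfolding prefix using 2(1) by (metis append.assoc)
    ultimately show ?thesis by blast
  qed
qed

text \<open>A long power of \<open>w\<close> leaves enough copies on one side of the cut to add or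
  delete one there. Deletion starts from \<open>Suc a\<close> or \<open>Suc b\<close> copies, so the
  longer power needs \<open>Suc a + Suc b\<close> of them; hence the threshold
  \<open>Suc (a + b)\<close>.\<close>

lemma stable_at_conc:
  assumes a: "stable_at w K a" and b: "stable_at w L b"
  shows "stable_at w (conc K L) (Suc (a + b))"
  unfolding stable_at_def
proof (intro allI iffI)
  fix x y
  let ?n = "Suc (a + b)"
  assume "x @ wpow w ?n @ y \<in> conc K L"
  then obtain u v where uv: "u @ v = x @ wpow w ?n @ y" "u \<in> K" "v \<in> L"
    by (auto simp: conc_def)
  from wpow_split[OF uv(1), of a b]
  consider y' where "u = x @ wpow w a @ y'" "y' @ v = wpow w (?n - a) @ y"
    | x' where "v = x' @ wpow w b @ y" "u @ x' = x @ wpow w (?n - b)" by auto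
  then show "x @ wpow w (Suc ?n) @ y \<in> conc K L"
  proof cases
    case 1
    have "x @ wpow w (Suc ?n) @ y = (x @ wpow w (Suc a) @ y') @ v"
      using 1 wpow_add[of w "Suc a" "?n - a"] by simp
    moreover have "x @ wpow w (Suc a) @ y' \<in> K" using a 1 uv unfolding stable_at_def by blast
    ultimately show ?thesis using uv(3) unfolding conc_def by blast
  next
    case 2
    have "x @ wpow w (Suc ?n) @ y = (x @ wpow w (?n - b)) @ wpow w (Suc b) @ y"
      using wpow_add[of w "?n - b" "Suc b"] by simp
    then have "x @ wpow w (Suc ?n) @ y = u @ (x' @ wpow w (Suc b) @ y)" using 2
      by (metis append.assoc)
    moreover have "x' @ wpow w (Suc b) @ y \<in> L" using b 2 uv unfolding stable_at_def by blast
    ultimately show ?thesis using uv(2) unfolding conc_def by blast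
  qed
next
  fix x y
  let ?n = "Suc (a + b)"
  assume "x @ wpow w (Suc ?n) @ y \<in> conc K L"
  then obtain u v where uv: "u @ v = x @ wpow w (Suc ?n) @ y" "u \<in> K" "v \<in> L"
    by (auto simp: conc_def)
  from wpow_split[OF uv(1), of "Suc a" "Suc b"]
  consider y' where "u = x @ wpow w (Suc a) @ y'" "y' @ v = wpow w (?n - a) @ y"
    | x' where "v = x' @ wpow w (Suc b) @ y" "u @ x' = x @ wpow w (?n - b)" by auto
  then show "x @ wpow w ?n @ y \<in> conc K L"
  proof cases
    case 1
    have "x @ wpow w ?n @ y = (x @ wpow w a @ y') @ v"
      using 1 wpow_add[of w a "?n - a"] by simp
    moreover have "x @ wpow w a @ y' \<in> K" using a 1 uv unfolding stable_at_def by blast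
    ultimately show ?thesis using uv(3) unfolding conc_def by blast
  next
    case 2
    have "x @ wpow w ?n @ y = (x @ wpow w (?n - b)) @ wpow w b @ y"
      using wpow_add[of w "?n - b" b] by simp
    then have "x @ wpow w ?n @ y = u @ (x' @ wpow w b @ y)" using 2 by (metis append.assoc)
    moreover have "x' @ wpow w b @ y \<in> L" using b 2 uv unfolding stable_at_def by blast
    ultimately show ?thesis using uv(2) unfolding conc_def by blast
  qed
qed

lemma stable_SF:
  assumes "\<And>L. L \<in> C \<Longrightarrow> \<exists>k. stable_at w L k" and "L \<in> SF C"
  shows "\<exists>k. stable_at w L k"
  using assms(2)
proof induction
  case (SF_base L)
  then show ?case using assms(1) by blast
next
  case (SF_letter b)
  \<comment> \<open>With exponent at least 2 and \<open>w\<close> nonempty, the word is too long to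
    be a single letter.\<close>
  have "stable_at w {[b]} 2"
  proof (cases "w = []")
    case True
    then show ?thesis by (simp add: stable_at_def)
  next
    case False
    then have "length w \<ge> 1" by (cases w) auto
    then have "length (x @ wpow w 2 @ y) \<noteq> 1" "length (x @ wpow w (Suc 2) @ y) \<noteq> 1"
      for x y
      by (auto simp: length_wpow)
    then show ?thesis unfolding stable_at_def
      by (metis One_nat_def length_Cons list.size(3) singletonD)
  qed
  then show ?case ..
next
  case (SF_union K L)
  then obtain a b where "stable_at w K a" "stable_at w L b" by blast
  then have "stable_at w K (a + b)" "stable_at w L (a + b)" by (auto intro: stable_at_mono)
  then have "stable_at w (K \<union> L) (a + b)" by (auto simp: stable_at_def)
  then show ?case ..
next
  case (SF_compl L)
  then show ?case by (auto simp: stable_at_def)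
next
  case (SF_conc K L)
  then show ?case using stable_at_conc by blast
qed

lemma stable_finite:
  assumes "finite KK" "\<And>K. K \<in> KK \<Longrightarrow> \<exists>k. stable_at w K k"
  shows "\<exists>k. \<forall>K\<in>KK. stable_at w K k"
proof -
  from assms(2) obtain f where f: "\<And>K. K \<in> KK \<Longrightarrow> stable_at w K (f K)"
    by metis
  have "stable_at w K (sum f KK)" if "K \<in> KK" for K
    using f[OF that] member_le_sum[OF that, of f] assms(1) by (auto intro: stable_at_mono)
  then show ?thesis by blast
qed

section \<open>The syntactic congruence of a finite family\<close>

text \<open>The class of \<open>w\<close> in the common syntactic congruence of the languages in
  \<open>KK\<close>, refined by \<open>\<eta>\<close>.\<close>

definition scong :: "('a list \<Rightarrow> 'n) \<Rightarrow> 'a list set set \<Rightarrow> 'a list \<Rightarrow> 'a list set" where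
  "scong \<eta> KK w = {v. \<eta> v = \<eta> w \<and> (\<forall>K\<in>KK. \<forall>x y. x @ v @ y \<in> K \<longleftrightarrow> x @ w @ y \<in> K)}"

lemma scong_self: "w \<in> scong \<eta> KK w"
  by (simp add: scong_def)

lemma scong_eqI: "v \<in> scong \<eta> KK w \<Longrightarrow> scong \<eta> KK v = scong \<eta> KK w"
  by (auto simp: scong_def)

lemma scong_subset: "w \<in> K \<Longrightarrow> K \<in> KK \<Longrightarrow> scong \<eta> KK w \<subseteq> K"
  unfolding scong_def by (auto, metis append_Nil append_Nil2)

lemma scong_conc:
  assumes "monoid_morphism \<eta>"
  shows "conc (scong \<eta> KK u) (scong \<eta> KK v) \<subseteq> scong \<eta> KK (u @ v)"
proof
  fix w assume "w \<in> conc (scong \<eta> KK u) (scong \<eta> KK v)"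
  then obtain u' v' where w: "w = u' @ v'" "u' \<in> scong \<eta> KK u" "v' \<in> scong \<eta> KK v"
    by (auto simp: conc_def)
  have "x @ w @ y \<in> K \<longleftrightarrow> x @ (u @ v) @ y \<in> K" if "K \<in> KK" for K x y
  proof -
    have "x @ w @ y \<in> K \<longleftrightarrow> x @ u' @ (v' @ y) \<in> K" using w by simp
    also have "\<dots> \<longleftrightarrow> x @ u @ (v' @ y) \<in> K" using w(2) that
      unfolding scong_def by blast
    also have "\<dots> \<longleftrightarrow> (x @ u) @ v' @ y \<in> K" by simp
    also have "\<dots> \<longleftrightarrow> (x @ u) @ v @ y \<in> K" using w(3) that
      unfolding scong_def by blast
    finally show ?thesis by simp
  qed
  then show "w \<in> scong \<eta> KK (u @ v)"
    using w assms by (simp add: scong_def monoid_morphism_def)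
qed

text \<open>A class is a fibre of \<open>\<eta>\<close> intersected with a Boolean combination of
  two-sided quotients of members of \<open>KK\<close>. These quotients are in \<open>SF C\<close>
  and finite in number, which gives both claims.\<close>

lemma scong_SF_finite:
  fixes C :: "'a::finite list set set" and \<eta> :: "'a list \<Rightarrow> 'n::finite"
  assumes emp: "{} \<in> C"
    and lq: "\<And>L u. L \<in> C \<Longrightarrow> lquot u L \<in> C" and rq: "\<And>L u. L \<in> C \<Longrightarrow> rquot u L \<in> C"
    and finC: "finite C"
    and \<eta>: "\<And>t. \<eta> -` {t} \<in> C"
    and KK: "finite KK" "KK \<subseteq> SF C"
  shows "scong \<eta> KK w \<in> SF C" and "finite (range (scong \<eta> KK))"
proof -
  define QQ where "QQ = {rquot y (lquot x K) | x y K. K \<in> KK}"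
  have finl: "finite (range (\<lambda>u. lquot u L))" if "L \<in> SF C" for L
    using finite_lquots_SF[OF _ that] lq finC by (metis finite_subset image_subsetI)
  have "QQ = (\<Union>K\<in>KK. \<Union>L\<in>range (\<lambda>x. lquot x K). range (\<lambda>y. rquot y L))"
    unfolding QQ_def by blast
  moreover have "finite (range (\<lambda>y. rquot y L))" if "K \<in> KK"
    "L \<in> range (\<lambda>x. lquot x K)" for K L
    using that KK(2) SF_lquot[OF emp lq] finl finite_rquots by blast
  ultimately have finQ: "finite QQ" using KK finl by (simp only:) (intro finite_UN_I; blast)
  have QSF: "Q \<in> SF C" if "Q \<in> QQ" for Q
    using that KK(2) SF_lquot[OF emp lq] SF_rquot[OF emp rq] unfolding QQ_def by blast
  have mem: "v \<in> rquot y (lquot x K) \<longleftrightarrow> x @ v @ y \<in> K" for v x y K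
    by (simp add: rquot_def lquot_def)
  have eq: "scong \<eta> KK w = \<eta> -` {\<eta> w} \<inter> (\<Inter>Q\<in>QQ. if w \<in> Q then Q else - Q)" for w
  proof -
    have "(\<forall>Q\<in>QQ. P Q) \<longleftrightarrow> (\<forall>K\<in>KK. \<forall>x y. P (rquot y (lquot x K)))" for P
      by (auto simp: QQ_def)
    then have "v \<in> scong \<eta> KK w \<longleftrightarrow> \<eta> v = \<eta> w \<and> (\<forall>Q\<in>QQ. v \<in> Q \<longleftrightarrow> w \<in> Q)" for v
      by (simp add: scong_def mem)
    then show ?thesis by auto
  qed
  show "scong \<eta> KK w \<in> SF C"
    unfolding eq by (intro SF_inter SF_base[OF \<eta>] SF_INT emp finQ) (auto intro: QSF SF_compl)
  \<comment> \<open>The class is a function of the image under \<open>\<eta>\<close> and of the set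
    of quotients containing \<open>w\<close>, hence takes finitely many values.\<close>
  have eq': "scong \<eta> KK w = (\<lambda>(t, P). \<eta> -` {t} \<inter> (\<Inter>Q\<in>QQ. if Q \<in> P then Q else - Q))
      (\<eta> w, {Q \<in> QQ. w \<in> Q})" for w
    unfolding eq by auto
  have "range (scong \<eta> KK) \<subseteq>
      (\<lambda>(t, P). \<eta> -` {t} \<inter> (\<Inter>Q\<in>QQ.
        if Q \<in> P then Q else - Q)) ` (UNIV \<times> Pow QQ)"
  proof (intro image_subsetI)
    fix w
    show "scong \<eta> KK w \<in>
        (\<lambda>(t, P). \<eta> -` {t} \<inter> (\<Inter>Q\<in>QQ.
          if Q \<in> P then Q else - Q)) ` (UNIV \<times> Pow QQ)"
      by (subst eq', rule imageI) blast
  qed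
  then show "finite (range (scong \<eta> KK))"
    using finQ by (meson finite finite_Pow_iff finite_SigmaI finite_imageI finite_subset)
qed

section \<open>Optimal imprints\<close>

lemma rle_trans: "rle r s \<Longrightarrow> rle s t \<Longrightarrow> rle (r::'r::semigroup_add) t"
  unfolding rle_def by (metis add.assoc)

lemma rle_mult:
  assumes "rle p q" "rle r s"
  shows "rle (p * r) (q * (s::'r::semiring_0))"
proof -
  have "rle (p * r) (q * r)" using assms(1) unfolding rle_def by (metis distrib_right)
  moreover have "rle (q * r) (q * s)" using assms(2) unfolding rle_def by (metis distrib_left)
  ultimately show ?thesis by (rule rle_trans)
qed

lemma rle_power:
  assumes "\<And>x::'r. x + x = x" "rle r (s::'r::{semiring_0,monoid_mult})"
  shows "rle (r ^ n) (s ^ n)"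
proof (induction n)
  case 0
  then show ?case using assms(1) by (simp add: rle_def)
next
  case (Suc n)
  then show ?case using rle_mult[OF assms(2)] by simp
qed

lemma rle_add:
  "rle r t \<Longrightarrow> rle s t \<Longrightarrow> rle (r + s) (t::'r::semigroup_add)"
  unfolding rle_def by (metis add.assoc)

lemma rating_mono:
  assumes "rating_map \<rho>" "K \<subseteq> L"
  shows "rle (\<rho> K) (\<rho> L)"
proof -
  have "\<rho> (K \<union> L) = \<rho> K + \<rho> L" using assms(1) unfolding rating_map_def
    by blast
  then show ?thesis using assms(2) unfolding rle_def by (simp add: Un_absorb1)
qed

text \<open>This removes the choice operator. A cover whose imprint has least cardinality is
  optimal: intersecting it memberwise with any other cover gives a cover whose imprint lies in both
  imprints, and minimality forces equality with the first.\<close>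

lemma opt_imprint_iff:
  fixes \<rho> :: "'a list set \<Rightarrow> 'r::{comm_monoid_add,finite}"
  assumes UN: "UNIV \<in> D" and int: "\<And>K L. K \<in> D \<Longrightarrow> L \<in> D \<Longrightarrow> K \<inter> L \<in> D"
    and \<rho>: "rating_map \<rho>"
  shows "r \<in> opt_imprint D L \<rho> \<longleftrightarrow> (\<forall>KK. is_D_cover D L KK \<longrightarrow> r \<in> imprint \<rho> KK)"
proof -
  have "is_D_cover D L {UNIV}" using UN by (simp add: is_D_cover_def is_cover_def)
  then obtain KK where KK: "is_D_cover D L KK"
    and min: "\<And>KK'. is_D_cover D L KK' \<Longrightarrow> card (imprint \<rho> KK) \<le> card (imprint \<rho> KK')"
    using ex_has_least_nat[of "is_D_cover D L" _ "\<lambda>KK. card (imprint \<rho> KK)"] by blast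
  have opt: "imprint \<rho> KK \<subseteq> imprint \<rho> KK'" if KK': "is_D_cover D L KK'" for KK'
  proof -
    let ?I = "(\<lambda>(K, K'). K \<inter> K') ` (KK \<times> KK')"
    have "is_D_cover D L ?I"
      unfolding is_D_cover_def is_cover_def
    proof (intro conjI subsetI)
      show "finite ?I" using KK KK' unfolding is_D_cover_def is_cover_def by blast
    next
      fix w assume "w \<in> L"
      then obtain K K' where "K \<in> KK" "w \<in> K" "K' \<in> KK'" "w \<in> K'"
        using KK KK' unfolding is_D_cover_def is_cover_def by blast
      then show "w \<in> \<Union>?I" by blast
    next
      fix M assume "M \<in> ?I"
      then obtain K K' where "K \<in> KK" "K' \<in> KK'" "M = K \<inter> K'" by blast
      then show "M \<in> D" using KK KK' int unfolding is_D_cover_def by blast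
    qed
    then have "card (imprint \<rho> KK) \<le> card (imprint \<rho> ?I)" by (rule min)
    moreover have sub: "imprint \<rho> ?I \<subseteq> imprint \<rho> KK \<inter> imprint \<rho> KK'"
    proof
      fix r assume "r \<in> imprint \<rho> ?I"
      then obtain K K' where K: "K \<in> KK" "K' \<in> KK'" "rle r (\<rho> (K \<inter> K'))"
        unfolding imprint_def by auto
      then have "rle r (\<rho> K)" "rle r (\<rho> K')"
        using rle_trans rating_mono[OF \<rho> Int_lower1] rating_mono[OF \<rho> Int_lower2]
          by blast+
      then show "r \<in> imprint \<rho> KK \<inter> imprint \<rho> KK'" using K
        unfolding imprint_def by blast
    qed
    ultimately have "imprint \<rho> ?I = imprint \<rho> KK"
      by (intro card_seteq) auto
    then show ?thesis using sub by blast
  qed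
  let ?P = "\<lambda>KK. is_D_cover D L KK \<and>
      (\<forall>KK'. is_D_cover D L KK' \<longrightarrow> imprint \<rho> KK \<subseteq> imprint \<rho> KK')"
  have "?P (Eps ?P)" by (rule someI[of ?P KK]) (use KK opt in blast)
  then show ?thesis unfolding opt_imprint_def by blast
qed

section \<open>Saturation of the optimal imprints\<close>

lemma saturated_opt_imprint:
  fixes C :: "'a::finite list set set"
    and \<eta> :: "'a list \<Rightarrow> 'n::{monoid_mult,finite}"
    and \<rho> :: "'a list set \<Rightarrow> 'r::{semiring_0,monoid_mult,finite}"
  assumes C: "prevariety C" "finite C"
    and \<eta>: "canonical_C_morphism C \<eta>"
    and \<rho>: "multiplicative_rating_map \<rho>"
    and \<omega>: "\<omega> > 0" "\<forall>r::'r. r ^ \<omega> * r ^ \<omega> = r ^ \<omega>"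
  shows "SF_saturated \<eta> \<rho> \<omega> {(t, r). r \<in> opt_imprint (SF C) (\<eta> -` {t}) \<rho>}"
proof -
  have emp: "{} \<in> C" using C(1) by (auto simp: prevariety_def lattice_def)
  have lq: "lquot u L \<in> C" and rq: "rquot u L \<in> C" if "L \<in> C" for L u
    using C(1) that by (auto simp: prevariety_def lquot_def rquot_def)
  have mor: "monoid_morphism \<eta>" and pre: "\<eta> -` F \<in> C" and rec: "L \<in> C \<Longrightarrow> \<exists>F. L = \<eta> -` F" for L F
    using \<eta> by (auto simp: canonical_C_morphism_def C_morphism_def)
  have \<eta>_app: "\<eta> (u @ v) = \<eta> u * \<eta> v" for u v
    using mor by (simp add: monoid_morphism_def)
  have rat: "rating_map \<rho>" and idem: "r + r = r" and \<rho>1: "\<rho> {[]} = 1"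
    and \<rho>_conc: "\<rho> (conc K L) = \<rho> K * \<rho> L" for K L and r :: 'r
    using \<rho> by (auto simp: multiplicative_rating_map_def rating_map_def)
  have iff: "r \<in> opt_imprint (SF C) L \<rho> \<longleftrightarrow>
      (\<forall>KK. is_D_cover (SF C) L KK \<longrightarrow> r \<in> imprint \<rho> KK)" for r L
    by (rule opt_imprint_iff; use SF_UNIV[OF emp] SF_inter rat in blast)
  have scong: "scong \<eta> KK w \<in> SF C" "finite (range (scong \<eta> KK))"
    if "finite KK" "KK \<subseteq> SF C" for KK w
    by (rule scong_SF_finite; use emp lq rq C(2) pre that in blast)+
  \<comment> \<open>The congruence classes inside the fibre of \<open>t\<close> form an
    \<open>SF C\<close>-cover of it, so every \<open>r\<close> in the optimal imprint lies below the
    rating of one of them.\<close>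
  have cls: "\<exists>w. \<eta> w = t \<and> rle r (\<rho> (scong \<eta> KK w))"
    if KK: "finite KK"
      "KK \<subseteq> SF C" and r: "r \<in> opt_imprint (SF C) (\<eta> -` {t}) \<rho>" for KK t r
  proof -
    have "is_D_cover (SF C) (\<eta> -` {t}) (scong \<eta> KK ` (\<eta> -` {t}))"
      unfolding is_D_cover_def is_cover_def
    proof (intro conjI)
      show "finite (scong \<eta> KK ` (\<eta> -` {t}))"
        using scong(2)[OF KK] by (rule finite_subset[rotated]) blast
      show "\<eta> -` {t} \<subseteq> \<Union> (scong \<eta> KK ` (\<eta> -` {t}))" using scong_self
        by fastforce
      show "scong \<eta> KK ` (\<eta> -` {t}) \<subseteq> SF C" using scong(1)[OF KK] by blast
    qed
    then show ?thesis using r unfolding iff imprint_def by auto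
  qed
  \<comment> \<open>Conversely, given a cover \<open>KK\<close>, the class of \<open>w\<close> for
    \<open>KK\<close> itself is contained in any member of \<open>KK\<close> that contains
    \<open>w\<close>; a bound by a class is therefore a bound by a member.\<close>
  have into: "r \<in> opt_imprint (SF C) (\<eta> -` {t}) \<rho>"
    if wit: "\<And>KK. finite KK \<Longrightarrow> KK \<subseteq> SF C \<Longrightarrow> \<eta> -` {t} \<subseteq> \<Union>KK \<Longrightarrow>
      \<exists>w. \<eta> w = t \<and> rle r (\<rho> (scong \<eta> KK w))" for r t
    unfolding iff
  proof (intro allI impI)
    fix KK assume "is_D_cover (SF C) (\<eta> -` {t}) KK"
    then have KK: "finite KK" "KK \<subseteq> SF C" "\<eta> -` {t} \<subseteq> \<Union>KK"
      by (auto simp: is_D_cover_def is_cover_def)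
    then obtain w where w: "\<eta> w = t" "rle r (\<rho> (scong \<eta> KK w))" using wit by blast
    then obtain K where K: "K \<in> KK" "w \<in> K" using KK(3) by blast
    then have "rle r (\<rho> K)" using rle_trans[OF w(2) rating_mono[OF rat scong_subset]] by blast
    then show "r \<in> imprint \<rho> KK" using K(1) unfolding imprint_def by blast
  qed
  have conc_le: "rle (\<rho> (scong \<eta> KK u) * \<rho> (scong \<eta> KK v)) (\<rho> (scong \<eta> KK (u @ v)))" for KK u v
    using rating_mono[OF rat scong_conc[OF mor]] unfolding \<rho>_conc .
  have pow_le: "rle (\<rho> (scong \<eta> KK w) ^ n) (\<rho> (scong \<eta> KK (wpow w n)))"
    for KK w n
  proof (induction n)
    case 0
    show ?case
      unfolding wpow_0 power_0 \<rho>1[symmetric]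
        by (rule rating_mono[OF rat]) (simp add: scong_self)
  next
    case (Suc n)
    have "rle (\<rho> (scong \<eta> KK w)) (\<rho> (scong \<eta> KK w))" using idem
      by (simp add: rle_def)
    from rle_trans[OF rle_mult[OF this Suc] conc_le] show ?case by (simp add: wpow_Suc)
  qed
  show ?thesis
    unfolding SF_saturated_def mem_Collect_eq prod.case
  proof (intro conjI allI impI; (elim conjE)?)
    fix w
    have "rle (\<rho> {w}) (\<rho> (scong \<eta> KK w))" for KK
      by (rule rating_mono[OF rat]) (simp add: scong_self)
    then show "\<rho> {w} \<in> opt_imprint (SF C) (\<eta> -` {\<eta> w}) \<rho>"
      by (intro into) blast
  next
    fix t r q assume "r \<in> opt_imprint (SF C) (\<eta> -` {t}) \<rho>" "rle q r"
    then show "q \<in> opt_imprint (SF C) (\<eta> -` {t}) \<rho>"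
      by (intro into) (meson cls rle_trans)
  next
    fix s q t r
    assume s: "q \<in> opt_imprint (SF C) (\<eta> -` {s}) \<rho>" and t: "r \<in> opt_imprint (SF C) (\<eta> -` {t}) \<rho>"
    show "q * r \<in> opt_imprint (SF C) (\<eta> -` {s * t}) \<rho>"
    proof (rule into)
      fix KK assume KK: "finite KK" "KK \<subseteq> SF C"
      from cls[OF KK s] cls[OF KK t] obtain u v
        where u: "\<eta> u = s" "rle q (\<rho> (scong \<eta> KK u))" and v: "\<eta> v = t"
          "rle r (\<rho> (scong \<eta> KK v))"
        by blast
      from rle_trans[OF rle_mult[OF u(2) v(2)] conc_le] u(1) v(1)
      show "\<exists>w. \<eta> w = s * t \<and> rle (q * r) (\<rho> (scong \<eta> KK w))"
        by (metis \<eta>_app)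
    qed
  next
    fix e r
    assume r: "r \<in> opt_imprint (SF C) (\<eta> -` {e}) \<rho>" and e: "e * e = e"
    show "r ^ \<omega> + r ^ (\<omega> + 1) \<in> opt_imprint (SF C) (\<eta> -` {e}) \<rho>"
    proof (rule into)
      fix KK assume KK: "finite KK" "KK \<subseteq> SF C"
      from cls[OF KK r] obtain w where w: "\<eta> w = e" "rle r (\<rho> (scong \<eta> KK w))"
        by blast
      \<comment> \<open>All positive powers of \<open>w\<close> have image \<open>e\<close>; the
        empty power has image 1. Every language of \<open>C\<close> is thus stable at 1, and
        stability extends to \<open>SF C\<close>.\<close>
      have \<eta>_pow: "\<eta> (wpow w (Suc n)) = e" for n
        by (induction n) (simp_all add: w e \<eta>_app wpow_Suc)
      have "\<exists>k. stable_at w L k" if "L \<in> C" for L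
      proof -
        from rec[OF that] obtain F where L: "L = \<eta> -` F" ..
        have "stable_at w L 1"
          using \<eta>_pow[of 0] \<eta>_pow[of 1] by (simp add: stable_at_def L \<eta>_app)
        then show ?thesis ..
      qed
      then have "\<exists>k. stable_at w K k" if "K \<in> KK" for K using stable_SF KK(2) that
        by blast
      from stable_finite[OF KK(1) this] obtain k where k: "\<And>K. K \<in> KK \<Longrightarrow> stable_at w K k"
        by blast
      \<comment> \<open>A multiple of \<open>\<omega>\<close> that is at least \<open>k\<close>: the
        powers \<open>n\<close> and \<open>Suc n\<close> of \<open>w\<close> are congruent, while
        \<open>r ^ n\<close> still equals \<open>r ^ \<omega>\<close>.\<close>
      define n where "n = \<omega> * Suc k"
      have "k \<le> n" "n > 0" using \<omega>(1) by (cases \<omega>; simp add: n_def)+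
      then have "stable_at w K n" if "K \<in> KK" for K using k[OF that] stable_at_mono by blast
      moreover have \<eta>n: "\<eta> (wpow w n) = e"
        using \<eta>_pow[of "n - 1"] \<open>n > 0\<close> by simp
      ultimately have "wpow w (Suc n) \<in> scong \<eta> KK (wpow w n)"
        using \<eta>_pow[of n] unfolding scong_def stable_at_def by auto
      then have eq: "scong \<eta> KK (wpow w (Suc n)) = scong \<eta> KK (wpow w n)"
        by (rule scong_eqI)
      have r\<omega>: "r ^ n = r ^ \<omega>"
      proof -
        have "(r ^ \<omega>) ^ Suc k = r ^ \<omega>" for k using \<omega>(2) by (induction k) auto
        then show ?thesis by (simp only: n_def power_mult)
      qed
      have "rle (r ^ m) (\<rho> (scong \<eta> KK (wpow w m)))" for m
        using rle_trans[OF rle_power[OF idem w(2)] pow_le] .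
      from this[of n] this[of "Suc n"] have "rle (r ^ n + r ^ Suc n) (\<rho> (scong \<eta> KK (wpow w n)))"
        unfolding eq by (rule rle_add)
      moreover have "r ^ n + r ^ Suc n = r ^ \<omega> + r ^ (\<omega> + 1)" by (simp add: r\<omega>)
      ultimately show "\<exists>w. \<eta> w = e \<and> rle (r ^ \<omega> + r ^ (\<omega> + 1)) (\<rho> (scong \<eta> KK w))"
        using \<eta>n by auto
    qed
  qed
qed

section \<open>Decomposing words at a distinguished letter\<close>

text \<open>The argument \<open>u\<close> accumulates the current factor without \<open>c\<close>.
  Each \<open>c\<close> closes a block, which becomes the single letter \<open>f u * c\<close>; a
  factor after the last \<open>c\<close> produces nothing.\<close>

primrec dec :: "'m::times \<Rightarrow> ('m list \<Rightarrow> 'm) \<Rightarrow> 'm list \<Rightarrow> 'm list \<Rightarrow> 'm list" where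
  "dec c f u [] = []"
| "dec c f u (a # w) = (if a = c then f u * c # dec c f [] w else dec c f (u @ [a]) w)"

inductive_set blocks :: "'m \<Rightarrow> 'm set \<Rightarrow> 'm list set" for c B where
  blocks_Nil: "[] \<in> blocks c B"
| blocks_step: "u \<in> lists B \<Longrightarrow> v \<in> blocks c B \<Longrightarrow> u @ c # v \<in> blocks c B"

lemma dec_block: "c \<notin> set u' \<Longrightarrow> dec c f u (u' @ c # w) = f (u @ u') * c # dec c f [] w"
  by (induction u' arbitrary: u) auto

lemma dec_tail: "c \<notin> set u' \<Longrightarrow> dec c f u u' = []"
  by (induction u' arbitrary: u) auto

lemma lists_notin: "u \<in> lists B \<Longrightarrow> c \<notin> B \<Longrightarrow> c \<notin> set u"
  by auto

lemma dec_append: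
  assumes "v \<in> blocks c B" "c \<notin> B"
  shows "dec c f [] (v @ w) = dec c f [] v @ dec c f [] w"
  using assms(1)
  by induction (simp_all add: dec_block lists_notin[OF _ assms(2)])

lemma blocks_append:
  assumes "v \<in> blocks c B" "w \<in> blocks c B"
  shows "v @ w \<in> blocks c B"
  using assms(1) by induction (simp_all add: assms(2) blocks.intros)

text \<open>Every letter of the decoded word comes from exactly one block, so a cut of it lifts to a
  cut between blocks. This makes preimages under \<open>dec\<close> commute with
  concatenation.\<close>

lemma blocks_split:
  assumes "v \<in> blocks c B" "c \<notin> B" "dec c f [] v = p @ q"
  shows "\<exists>v1\<in>blocks c B. \<exists>v2\<in>blocks c B. v = v1 @ v2 \<and> dec c f [] v1 = p \<and> dec c f [] v2 = q"
  using assms(1,3)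
proof (induction arbitrary: p)
  case blocks_Nil
  then show ?case by (auto intro!: bexI[of _ "[]"] blocks.blocks_Nil)
next
  case (blocks_step u v)
  have c: "c \<notin> set u" using blocks_step(1) assms(2) by (rule lists_notin)
  show ?case
  proof (cases p)
    case Nil
    then show ?thesis using blocks_step
      by (intro bexI[of _ "[]"] bexI[of _ "u @ c # v"]) (auto intro: blocks.intros)
  next
    case (Cons a p')
    then have "dec c f [] v = p' @ q" "a = f u * c" using blocks_step.prems c
      by (simp_all add: dec_block)
    then obtain v1 v2 where "v1 \<in> blocks c B" "v2 \<in> blocks c B"
      "v = v1 @ v2" "dec c f [] v1 = p'" "dec c f [] v2 = q" using blocks_step.IH by blast
    then show ?thesis using \<open>a = _\<close> Cons c blocks_step(1)
      by (intro bexI[of _ "u @ c # v1"] bexI[of _ v2]) (auto intro: blocks.intros simp: dec_block)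
  qed
qed

lemma snoc_in_blocks: "w \<in> lists (insert c B) \<Longrightarrow> w @ [c] \<in> blocks c B"
proof (induction w rule: length_induct)
  case (1 w)
  show ?case
  proof (cases "c \<in> set w")
    case True
    then obtain u v where w: "w = u @ c # v" "c \<notin> set u" by (meson split_list_first)
    then have "u \<in> lists B" "v @ [c] \<in> blocks c B" using 1 by (auto simp: lists_eq_set)
    then show ?thesis using w blocks_step by fastforce
  next
    case False
    then have "w \<in> lists B" using 1 by (auto simp: lists_eq_set)
    then show ?thesis by (rule blocks_step[OF _ blocks_Nil])
  qed
qed

text \<open>The inductive definition iterates blocks, as a star would; this description uses no
  iteration and so shows the set to be star-free.\<close>

lemma blocks_eq: "blocks c B = {[]} \<union> conc (lists (insert c B)) {[c]}"
proof (intro equalityI subsetI)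
  fix w assume "w \<in> blocks c B"
  then show "w \<in> {[]} \<union> conc (lists (insert c B)) {[c]}"
  proof induction
    case blocks_Nil
    then show ?case by simp
  next
    case (blocks_step u v)
    then have u: "u \<in> lists (insert c B)" by (auto simp: lists_eq_set)
    from blocks_step.IH consider "v = []" | v' where "v = v' @ [c]" "v' \<in> lists (insert c B)"
      by (auto simp: conc_def)
    then show ?case
    proof cases
      case 1
      then show ?thesis using u by (auto simp: conc_def)
    next
      case 2
      then have "u @ c # v = (u @ c # v') @ [c]" "u @ c # v' \<in> lists (insert c B)" using u
        by auto
      then show ?thesis unfolding conc_def by blast
    qed
  qed
next
  fix w assume "w \<in> {[]} \<union> conc (lists (insert c B)) {[c]}"
  then show "w \<in> blocks c B"
    using snoc_in_blocks[of _ c B] blocks_Nil[of c B] unfolding conc_def by blast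
qed

lemma blocks_lists: "v \<in> blocks c B \<Longrightarrow> v \<in> lists (insert c B)"
  by (auto simp: blocks_eq conc_def)

lemma last_block:
  assumes "v \<in> blocks c B" "c \<notin> set u"
  shows "rev (takeWhile (\<lambda>a. a \<noteq> c) (rev (v @ u))) = u"
proof -
  consider "v = []" | v' where "v = v' @ [c]" using assms(1) by (auto simp: blocks_eq conc_def)
  then show ?thesis
  proof cases
    case 1
    have "takeWhile (\<lambda>a. a \<noteq> c) (rev u) = rev u"
      using assms(2) by (auto simp: takeWhile_eq_all_conv)
    then show ?thesis by (simp only: 1 append_Nil rev_rev_ident)
  next
    case 2
    have "takeWhile (\<lambda>a. a \<noteq> c) (rev u @ c # rev v') = rev u"
      using assms(2) by (subst takeWhile_append2) auto
    then show ?thesis using 2 by simp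
  qed
qed

lemma decompose_blocks:
  assumes "w \<in> lists (insert c B)" "c \<in> set w"
  shows "\<exists>u\<in>lists B. \<exists>v\<in>blocks c B. \<exists>u'\<in>lists B. w = u @ c # v @ u'"
proof -
  obtain u z where w: "w = u @ c # z" "c \<notin> set u" using assms(2) by (meson split_list_first)
  have u: "u \<in> lists B" using w assms(1) by (auto simp: lists_eq_set)
  show ?thesis
  proof (cases "c \<in> set z")
    case True
    then obtain v u' where z: "z = v @ c # u'" "c \<notin> set u'" by (meson split_list_last)
    then have "v \<in> lists (insert c B)" "u' \<in> lists B" using w assms(1)
      by (auto simp: lists_eq_set)
    then show ?thesis using w z u snoc_in_blocks[of v]
      by (intro bexI[of _ u] bexI[of _ "v @ [c]"] bexI[of _ u']) auto
  next
    case False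
    then have "z \<in> lists B" using w assms(1) by (auto simp: lists_eq_set)
    then show ?thesis using w u
      by (intro bexI[of _ u] bexI[of _ "[]"] bexI[of _ z]) (auto intro: blocks_Nil)
  qed
qed

section \<open>Weights\<close>

instantiation prod :: (monoid_mult, monoid_mult) monoid_mult
begin

definition one_prod_def: "1 = (1, 1)"

definition times_prod_def: "p * q = (fst p * fst q, snd p * snd q)"

instance
  by standard (simp_all add: one_prod_def times_prod_def mult.assoc)

end

lemma fst_mult [simp]: "fst (p * q) = fst p * fst q"
  by (simp add: times_prod_def)

lemma snd_mult [simp]: "snd (p * q) = snd p * snd q"
  by (simp add: times_prod_def)

lemma fst_one_prod [simp]: "fst 1 = 1"
  by (simp add: one_prod_def)

lemma snd_one_prod [simp]: "snd 1 = 1"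
  by (simp add: one_prod_def)

lemma fst_power [simp]: "fst (p ^ n) = fst p ^ n"
  by (induction n) simp_all

lemma snd_power [simp]: "snd (p ^ n) = snd p ^ n"
  by (induction n) simp_all

text \<open>By pigeonhole two powers coincide, so the powers are eventually periodic.\<close>

lemma finite_idempotent_power:
  fixes g :: "'m::{monoid_mult,finite}"
  shows "\<exists>p>0. g ^ p * g ^ p = g ^ p"
proof -
  have "\<not> inj (\<lambda>n::nat. g ^ n)"
    using finite_imageD[of "\<lambda>n::nat. g ^ n" UNIV]
      by (auto intro: finite_subset[OF subset_UNIV])
  then obtain i j :: nat where "g ^ i = g ^ j" "i < j"
    by (metis injI linorder_neqE_nat)
  then obtain d where d: "d > 0" "g ^ (i + d) = g ^ i" by (metis less_imp_add_positive)
  have step: "g ^ (n + d) = g ^ n" if "n \<ge> i" for n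
  proof -
    have "g ^ (n + d) = g ^ (n - i) * g ^ (i + d)" using that by (simp flip: power_add)
    also have "\<dots> = g ^ n" unfolding d(2) using that by (simp flip: power_add)
    finally show ?thesis .
  qed
  have steps: "g ^ (n + k * d) = g ^ n" if "n \<ge> i" for n k
  proof (induction k)
    case (Suc k)
    then show ?case using step[of "n + k * d"] that by (simp add: ac_simps)
  qed simp
  \<comment> \<open>A multiple of the period beyond the preperiod; \<open>Suc i\<close> in place of
    \<open>i\<close> keeps it positive when \<open>i = 0\<close>.\<close>
  have "i \<le> Suc i * d" using d(1) by (cases d) auto
  then have "g ^ (Suc i * d + Suc i * d) = g ^ (Suc i * d)" by (rule steps)
  then show ?thesis using d(1) by (intro exI[of _ "Suc i * d"]) (simp flip: power_add)
qed

lemma power_stable: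
  assumes "g ^ Suc k = (g::'m::monoid_mult) ^ k" "k \<le> n"
  shows "g ^ n = g ^ k"
  using assms(2)
proof (induction n rule: dec_induct)
  case (step n)
  then have "g ^ Suc n = g * g ^ k" by simp
  then show ?case using assms(1) by simp
qed simp

definition ple :: "'n \<times> 'r::plus \<Rightarrow> 'n \<times> 'r \<Rightarrow> bool" where
  "ple p q \<longleftrightarrow> fst p = fst q \<and> rle (snd p) (snd q)"

lemma ple_trans: "ple p q \<Longrightarrow> ple q s \<Longrightarrow> ple (p::'n \<times> 'r::semigroup_add) s"
  unfolding ple_def using rle_trans by metis

lemma ple_mult_right:
  "ple p q \<Longrightarrow> ple (p * s) (q * (s::'n::monoid_mult \<times> 'r::{semiring_0,monoid_mult}))"
  unfolding ple_def rle_def by (simp flip: distrib_right)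

text \<open>Every element of \<open>X\<close> has the form \<open>y * g\<close>, on which a further
  \<open>g\<close> has no effect.\<close>

lemma fixed_by_idempotent:
  assumes "(\<lambda>x. x * g) ` X = X" "g * g = (g::'m::monoid_mult)" "x \<in> X"
  shows "x * g = x"
proof -
  obtain y where "x = y * g" using assms(1,3) by blast
  then show ?thesis using assms(2) by (simp add: mult.assoc)
qed

lemma permutes_mult:
  assumes "(\<lambda>x. x * g) ` X = X" "(\<lambda>x. x * h) ` X = (X :: 'm::monoid_mult set)"
  shows "(\<lambda>x. x * (g * h)) ` X = X"
proof -
  have "(\<lambda>x. x * (g * h)) ` X = (\<lambda>x. x * h) ` (\<lambda>x. x * g) ` X"
    by (simp add: image_image mult.assoc)
  then show ?thesis using assms by simp
qed

lemma permutes_power: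
  assumes "(\<lambda>x. x * g) ` X = (X :: 'm::monoid_mult set)"
  shows "(\<lambda>x. x * g ^ n) ` X = X"
proof (induction n)
  case (Suc n)
  then show ?case using permutes_mult[OF assms] by simp
qed simp

lemma permutes_prod_list:
  assumes "\<And>b. b \<in> B \<Longrightarrow> (\<lambda>x. x * b) ` X = (X :: 'm::monoid_mult set)" "w \<in> lists B"
  shows "(\<lambda>x. x * prod_list w) ` X = X"
  using assms(2)
proof induction
  case (Cons b w)
  then show ?case using permutes_mult[OF assms(1)] by simp
qed simp

text \<open>The base languages for words over weights: membership depends only on how the first
  component of the product acts on the first components of \<open>X\<close>. Shrinking
  \<open>X\<close> coarsens the action and leaves fewer languages.\<close>

definition act_langs :: "('n::monoid_mult \<times> 'r::monoid_mult) set \<Rightarrow> ('n \<times> 'r) list set set" where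
  "act_langs X = {L. \<forall>w w'. (\<forall>x\<in>X. fst x * fst (prod_list w) = fst x * fst (prod_list w'))
     \<longrightarrow> (w \<in> L \<longleftrightarrow> w' \<in> L)}"

lemma empty_act_langs: "{} \<in> act_langs X"
  by (simp add: act_langs_def)

section \<open>The closure of a set of weights, and labellings with values in it\<close>

locale idempotent_power =
  fixes \<omega> :: nat and type_r :: "'r::{semiring_0,monoid_mult,finite} itself"
  assumes add_idem: "(r::'r) + r = r"
    and \<omega>_pos: "\<omega> > 0" and \<omega>_idem: "(r::'r) ^ \<omega> * r ^ \<omega> = r ^ \<omega>"
begin

lemma ple_refl: "ple p (p::'n \<times> 'r)"
  by (simp add: ple_def rle_def add_idem)

inductive_set W :: "('n::{monoid_mult,finite} \<times> 'r) set \<Rightarrow> ('n \<times> 'r) set"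
  for B where
  W_one: "1 \<in> W B"
| W_gen: "b \<in> B \<Longrightarrow> b \<in> W B"
| W_mult: "p \<in> W B \<Longrightarrow> q \<in> W B \<Longrightarrow> p * q \<in> W B"
| W_idem: "p \<in> W B \<Longrightarrow> fst p * fst p = fst p \<Longrightarrow> (fst p, snd p ^ \<omega> + snd p ^ Suc \<omega>) \<in> W B"

lemma W_subset:
  assumes "T \<subseteq> W B"
  shows "W T \<subseteq> W B"
proof
  fix p assume "p \<in> W T"
  then show "p \<in> W B" by induction (use assms in \<open>blast intro: W.intros\<close>)+
qed

lemma W_mono: "B \<subseteq> B' \<Longrightarrow> W B \<subseteq> W B'"
  by (rule W_subset) (auto intro: W_gen)

lemma W_power: "p \<in> W B \<Longrightarrow> p ^ n \<in> W B"
  by (induction n) (auto intro: W.intros)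

lemma W_prod_list: "w \<in> lists B \<Longrightarrow> prod_list w \<in> W B"
  by (induction w) (auto intro: W.intros)

text \<open>Right multiples of \<open>c\<close>, with 1 added, are stable under all operations of
  \<open>W\<close>. This keeps the new alphabet acting on \<open>X * c\<close>.\<close>

lemma W_local:
  assumes c: "c \<in> W B" and T: "T \<subseteq> (\<lambda>p. p * c) ` W B"
  shows "W T \<subseteq> insert 1 ((\<lambda>p. p * c) ` W B)"
proof
  fix p assume "p \<in> W T"
  then show "p \<in> insert 1 ((\<lambda>p. p * c) ` W B)"
  proof induction
    case W_one
    then show ?case by simp
  next
    case (W_gen b)
    then show ?case using T by blast
  next
    case (W_mult p q)
    then consider "p = 1" | "q = 1" | p' q' where "p = p' * c" "q = q' * c" "p' \<in> W B"
      "q' \<in> W B"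
      by blast
    then show ?case
    proof cases
      case 3
      then have "p * q = (p' * c * q') * c" "p' * c * q' \<in> W B"
        using c by (simp_all add: mult.assoc W.W_mult)
      then show ?thesis by blast
    qed (use W_mult in simp_all)
  next
    case (W_idem p)
    let ?h = "(fst p, snd p ^ \<omega> + snd p ^ Suc \<omega>)"
    show ?case
    proof (cases "p = 1")
      case True
      then have "?h = 1" by (simp add: one_prod_def add_idem)
      then show ?thesis by simp
    next
      case False
      then obtain p' where p': "p = p' * c" "p' \<in> W B" using W_idem.IH by blast
      then have pW: "p \<in> W B" using c by (simp add: W.W_mult)
      have "fst p ^ Suc n = fst p" for n using W_idem.hyps by (induction n) simp_all
      from this[of "\<omega> - 1"] have fst\<omega>: "fst p ^ \<omega> = fst p" using \<omega>_pos
        by simp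
      \<comment> \<open>Absorbing \<open>r ^ \<omega>\<close> leaves
        \<open>r ^ \<omega> + r ^ Suc \<omega>\<close> unchanged, so \<open>?h\<close> can be
        written with a final factor \<open>p\<close>, and hence with a final
        \<open>c\<close>.\<close>
      have "?h = ?h * p ^ \<omega>"
        by (rule prod_eqI) (simp_all add: fst\<omega> W_idem.hyps distrib_right \<omega>_idem mult.assoc)
      also have "p ^ \<omega> = p ^ (\<omega> - 1) * p" using \<omega>_pos
        by (metis Suc_diff_1 power_Suc2)
      also have "?h * (p ^ (\<omega> - 1) * p) = (?h * p ^ (\<omega> - 1) * p') * c"
        unfolding p'(1) by (simp add: mult.assoc)
      finally have "?h = (?h * p ^ (\<omega> - 1) * p') * c" .
      moreover have "?h * p ^ (\<omega> - 1) * p' \<in> W B"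
        by (intro W.W_mult W.W_idem W_power pW p' W_idem.hyps)
      ultimately show ?thesis by blast
    qed
  qed
qed

definition closed_act :: "('n::{monoid_mult,finite} \<times> 'r) set \<Rightarrow> ('n \<times> 'r) set \<Rightarrow> bool" where
  "closed_act B X \<longleftrightarrow> (\<forall>x\<in>X. \<forall>p\<in>W B. x * p \<in> X)"

text \<open>Aperiodicity of the first component of a weight can be tested on \<open>X\<close>. This is what remains of
  \<open>1 \<in> X\<close> after \<open>X\<close> has been replaced by \<open>X * c\<close>.\<close>

definition detects_aperiodic :: "('n::{monoid_mult,finite} \<times> 'r) set \<Rightarrow> ('n \<times> 'r) set \<Rightarrow> bool" where
  "detects_aperiodic B X \<longleftrightarrow> (\<forall>p\<in>W B. (\<exists>k. \<forall>x\<in>X. fst x * fst p ^ Suc k = fst x * fst p ^ k)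
     \<longrightarrow> (\<exists>k. fst p ^ Suc k = fst p ^ k))"

definition labels :: "('n::{monoid_mult,finite} \<times> 'r) set \<Rightarrow> ('n \<times> 'r) set
    \<Rightarrow> (('n \<times> 'r) list \<Rightarrow> 'n \<times> 'r) \<Rightarrow> bool" where
  "labels B X f \<longleftrightarrow>
     (\<forall>w\<in>lists B. f w \<in> W B \<and> (\<forall>x\<in>X. ple (x * prod_list w) (x * f w))) \<and>
     (\<forall>p. {w \<in> lists B. f w = p} \<in> SF (act_langs X))"

section \<open>Weights acting as permutations\<close>

text \<open>On second components of \<open>X\<close> the witness acts as \<open>1 + u\<close>. The
  idempotent operation provides such an element once \<open>u\<close> is replaced by a power with
  idempotent first component; aperiodicity of \<open>fst u\<close>, detected on \<open>X\<close>,
  yields that power.\<close>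

lemma permutation_bound:
  assumes det: "detects_aperiodic B X"
    and u: "u \<in> W B" "(\<lambda>x. x * u) ` X = X"
      "\<And>x. x \<in> X \<Longrightarrow> fst x * fst u = fst x"
  shows "\<exists>h\<in>W B. \<forall>x\<in>X. ple x (x * h) \<and> ple (x * u) (x * h)"
proof -
  have "\<exists>k. \<forall>x\<in>X. fst x * fst u ^ Suc k = fst x * fst u ^ k"
    using u(3) by (intro exI[of _ 0]) simp
  then obtain k where k: "fst u ^ Suc k = fst u ^ k"
    using det u(1) unfolding detects_aperiodic_def by blast
  obtain q where q: "q > 0" "u ^ q * u ^ q = u ^ q" using finite_idempotent_power by blast
  have uq: "x * u ^ q = x" if "x \<in> X" for x
    using fixed_by_idempotent[OF permutes_power[OF u(2)] q(2) that] .
  \<comment> \<open>\<open>s\<close> acts on \<open>X\<close> like \<open>u\<close>, but its first component is idempotent, so that \<open>W_idem\<close> applies.\<close>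
  define s where "s = u ^ Suc (q * k)"
  have sW: "s \<in> W B" unfolding s_def by (rule W_power[OF u(1)])
  have xs: "x * s = x * u" if "x \<in> X" for x
  proof -
    have "x * (u ^ q) ^ k = x"
      by (induction k) (simp_all add: uq[OF that] power_Suc2 flip: mult.assoc power_Suc)
    then show ?thesis by (simp only: s_def power_Suc2 power_mult flip: mult.assoc)
  qed
  have "fst u ^ n = fst u ^ k" if "k \<le> n" for n using power_stable[OF k that] .
  moreover have "k \<le> Suc (q * k)" using q(1) by (cases q) auto
  ultimately have fs: "fst s * fst s = fst s"
    unfolding s_def fst_power by (metis le_add1 power_add order_trans)
  define h where "h = (fst s, snd s ^ \<omega> + snd s ^ Suc \<omega>)"
  have hW: "h \<in> W B" unfolding h_def by (rule W_idem[OF sW fs])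
  have ps: "(\<lambda>x. x * s) ` X = X" unfolding s_def by (rule permutes_power[OF u(2)])
  have "fst s ^ Suc n = fst s" for n using fs by (induction n) simp_all
  from this[of "\<omega> - 1"] have fst\<omega>: "fst s ^ \<omega> = fst s" using \<omega>_pos
    by simp
  have "s ^ \<omega> * s ^ \<omega> = s ^ \<omega>"
    by (rule prod_eqI) (simp_all add: fst\<omega> fs \<omega>_idem)
  \<comment> \<open>An idempotent that permutes \<open>X\<close> acts as the identity on it, so
    \<open>s ^ \<omega>\<close> and \<open>s ^ Suc \<omega>\<close> act like 1 and
    \<open>u\<close>.\<close>
  then have s\<omega>: "x * s ^ \<omega> = x" if "x \<in> X" for x
    using fixed_by_idempotent[OF permutes_power[OF ps]] that by blast
  have "ple x (x * h) \<and> ple (x * u) (x * h)" if "x \<in> X" for x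
  proof -
    have "snd x * snd s ^ \<omega> = snd x" using arg_cong[OF s\<omega>[OF that], of snd] by simp
    then have "snd (x * h) = snd x + snd x * snd s"
      by (simp add: h_def distrib_left power_Suc2 del: power_Suc flip: mult.assoc)
    also have "snd x * snd s = snd x * snd u" using arg_cong[OF xs[OF that], of snd] by simp
    finally have "snd (x * h) = snd x + snd x * snd u" .
    moreover have "fst (x * h) = fst x"
      using arg_cong[OF xs[OF that], of fst] u(3)[OF that] by (simp add: h_def)
    ultimately show ?thesis using u(3)[OF that] unfolding ple_def rle_def
      by (simp add: add_idem add.left_commute flip: add.assoc)
  qed
  then show ?thesis using hW by blast
qed

text \<open>Dividing by one fixed \<open>g1\<close> in \<open>G\<close> makes all elements act
  trivially on first components, where the preceding bound applies. The bounds are multiplied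
  together, and \<open>g1\<close> is put back in front.\<close>

lemma permutation_bound_finite:
  assumes closed: "closed_act B X" and det: "detects_aperiodic B X"
    and G: "finite G" "G \<subseteq> W B"
      "\<And>g. g \<in> G \<Longrightarrow> (\<lambda>x. x * g) ` X = X"
    and same: "\<And>g h x. g \<in> G \<Longrightarrow> h \<in> G \<Longrightarrow> x \<in> X \<Longrightarrow> fst x * fst g = fst x * fst h"
  shows "\<exists>p\<in>W B. \<forall>g\<in>G. \<forall>x\<in>X. ple (x * g) (x * p)"
proof (cases "G = {}")
  case True
  then show ?thesis using W_one by blast
next
  case False
  then obtain g1 where g1: "g1 \<in> G" by blast
  then have g1W: "g1 \<in> W B" using G(2) by blast
  obtain p where p: "p > 0" "g1 ^ p * g1 ^ p = g1 ^ p" using finite_idempotent_power by blast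
  have g1p: "x * g1 ^ p = x" if "x \<in> X" for x
    using fixed_by_idempotent[OF permutes_power[OF G(3)[OF g1]] p(2) that] .
  \<comment> \<open>As \<open>g1 ^ p\<close> is the identity on \<open>X\<close>, this is the
    inverse of the action of \<open>g1\<close>.\<close>
  define k where "k = g1 ^ (p - 1)"
  have kW: "k \<in> W B" unfolding k_def by (rule W_power[OF g1W])
  have kg1: "k * g1 = g1 ^ p" "g1 * k = g1 ^ p"
    using p(1) unfolding k_def by (metis Suc_diff_1 power_Suc2, metis Suc_diff_1 power_Suc)
  have xk: "x * q \<in> X" if "x \<in> X" "q \<in> W B" for x q using closed that
    unfolding closed_act_def by blast
  have one: "\<exists>h\<in>W B. \<forall>x\<in>X. ple x (x * h) \<and> ple (x * (k * g)) (x * h)"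
    if g: "g \<in> G" for g
  proof (rule permutation_bound[OF det])
    show "k * g \<in> W B" using kW G(2) g by (auto intro: W.intros)
    show "(\<lambda>x. x * (k * g)) ` X = X"
      unfolding k_def by (rule permutes_mult[OF permutes_power]) (use G(3) g g1 in blast)+
    fix x assume x: "x \<in> X"
    have "fst x * fst (k * g) = fst (x * k) * fst g" by (simp add: mult.assoc)
    also have "\<dots> = fst (x * k) * fst g1" by (rule same[OF g g1 xk[OF x kW]])
    also have "\<dots> = fst (x * (k * g1))" by (simp add: mult.assoc)
    also have "\<dots> = fst x" unfolding kg1 g1p[OF x] ..
    finally show "fst x * fst (k * g) = fst x" .
  qed
  have "\<exists>z\<in>W B. \<forall>x\<in>X. ple x (x * z) \<and> (\<forall>g\<in>G'. ple (x * (k * g)) (x * z))" if "G' \<subseteq> G" for G'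
    using finite_subset[OF that G(1)] that
  proof (induction G')
    case empty
    then show ?case using W_one by (intro bexI[of _ 1]) (simp_all add: ple_refl)
  next
    case (insert g G')
    then obtain z where z: "z \<in> W B" "\<And>x. x \<in> X \<Longrightarrow> ple x (x * z)"
      "\<And>x g. x \<in> X \<Longrightarrow> g \<in> G' \<Longrightarrow> ple (x * (k * g)) (x * z)" by auto
    obtain h where h: "h \<in> W B" "\<And>x. x \<in> X \<Longrightarrow> ple x (x * h)"
      "\<And>x. x \<in> X \<Longrightarrow> ple (x * (k * g)) (x * h)" using one[of g] insert.prems
        by blast
    \<comment> \<open>Both factors dominate the identity on \<open>X\<close>, so the product
      dominates each factor: \<open>z\<close> is applied at \<open>x * h\<close>, and
      \<open>x <= x * h\<close> is multiplied by \<open>z\<close>.\<close>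
    have "ple x (x * (h * z)) \<and> (\<forall>g'\<in>insert g G'. ple (x * (k * g')) (x * (h * z)))" if x: "x \<in> X" for x
    proof -
      have hz: "ple (x * h) (x * (h * z))" using z(2)[OF xk[OF x h(1)]] by (simp add: mult.assoc)
      have zz: "ple (x * z) (x * (h * z))" using ple_mult_right[OF h(2)[OF x], of z]
        by (simp add: mult.assoc)
      show ?thesis using ple_trans[OF _ hz] ple_trans[OF _ zz] h(2,3)[OF x] z(3)[OF x] by blast
    qed
    then show ?case using W_mult[OF h(1) z(1)] by blast
  qed
  from this[OF order_refl] obtain z where z: "z \<in> W B"
    "\<And>x g. x \<in> X \<Longrightarrow> g \<in> G \<Longrightarrow> ple (x * (k * g)) (x * z)"
      by blast
  have "ple (x * g) (x * (g1 * z))" if "g \<in> G" "x \<in> X" for g x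
  proof -
    have "x * g1 * (k * g) = x * (g1 * k) * g" by (simp add: mult.assoc)
    also have "\<dots> = x * g" unfolding kg1 g1p[OF that(2)] ..
    finally show ?thesis using z(2)[OF xk[OF that(2) g1W] that(1)] by (simp add: mult.assoc)
  qed
  then show ?thesis using W_mult[OF g1W z(1)] by blast
qed

text \<open>Words with the same action on first components have finitely many products, as there are
  finitely many weights, so a single label serves them all. Its fibres are then base languages cut
  down to \<open>lists B\<close>.\<close>

lemma labels_permutation:
  fixes B X :: "('n::{monoid_mult,finite} \<times> 'r) set"
  assumes closed: "closed_act B X" and det: "detects_aperiodic B X"
    and perm: "\<And>b. b \<in> B \<Longrightarrow> (\<lambda>x. x * b) ` X = X"
  shows "\<exists>f. labels B X f"
proof -
  \<comment> \<open>The constant value outside \<open>X\<close> makes equality of these functions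
    mean equal action on \<open>X\<close>.\<close>
  define act where "act w = (\<lambda>x. if x \<in> X then fst x * fst (prod_list w) else 1)"
    for w :: "('n \<times> 'r) list"
  have act_eq: "act w = act w' \<longleftrightarrow> (\<forall>x\<in>X. fst x * fst (prod_list w) = fst x * fst (prod_list w'))" for w w'
    unfolding act_def fun_eq_iff by auto
  have bound: "\<exists>p\<in>W B. \<forall>g\<in>prod_list ` {w \<in> lists B. act w = t}. \<forall>x\<in>X. ple (x * g) (x * p)" for t
  proof (rule permutation_bound_finite[OF closed det])
    show "prod_list ` {w \<in> lists B. act w = t} \<subseteq> W B" using W_prod_list by blast
  next
    fix g assume "g \<in> prod_list ` {w \<in> lists B. act w = t}"
    then show "(\<lambda>x. x * g) ` X = X" using permutes_prod_list[OF perm] by blast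
  next
    fix g h x
    assume "g \<in> prod_list ` {w \<in> lists B. act w = t}"
      "h \<in> prod_list ` {w \<in> lists B. act w = t}" "x \<in> X"
    then obtain w w' where "g = prod_list w" "h = prod_list w'" "act w = act w'" by auto
    then show "fst x * fst g = fst x * fst h" using \<open>x \<in> X\<close> unfolding act_eq
      by simp
  qed simp
  have "\<exists>p. p \<in> W B \<and> (\<forall>w\<in>lists B. act w = t \<longrightarrow> (\<forall>x\<in>X. ple (x * prod_list w) (x * p)))" for t
  proof -
    obtain p where "p \<in> W B"
      and p: "\<And>g x. g \<in> prod_list ` {w \<in> lists B. act w = t} \<Longrightarrow> x \<in> X \<Longrightarrow> ple (x * g) (x * p)"
      using bound[of t] by meson
    then show ?thesis using p[OF imageI] by (intro exI[of _ p]) simp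
  qed
  then obtain s where s: "\<And>t. s t \<in> W B"
    "\<And>t w x. w \<in> lists B \<Longrightarrow> act w = t \<Longrightarrow> x \<in> X \<Longrightarrow> ple (x * prod_list w) (x * s t)" by metis
  have "{w. s (act w) = p} \<in> act_langs X" for p
    unfolding act_langs_def mem_Collect_eq act_eq[symmetric] by simp
  then have "lists B \<inter> {w. s (act w) = p} \<in> SF (act_langs X)" for p
    by (rule SF_inter[OF SF_lists[OF empty_act_langs] SF_base])
  then have "labels B X (\<lambda>w. s (act w))"
    unfolding labels_def using s by (simp add: Int_def)
  then show ?thesis by blast
qed

section \<open>Labelling words by weights\<close>

text \<open>A word is cut at its first and last \<open>c\<close>. The outer factors are labelled by
  \<open>f1\<close>; the blocks in between are decoded to a word over the new alphabet, labelled by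
  \<open>f2\<close>. The latter need only dominate on \<open>X * c\<close>, where every prefix
  ending in \<open>c\<close> leads.\<close>

lemma labels_step:
  fixes B X :: "('n::{monoid_mult,finite} \<times> 'r) set"
  assumes closed: "closed_act B X" and cB: "c \<in> B"
    and f1: "labels (B - {c}) X f1"
    and f2: "labels ((\<lambda>u. f1 u * c) ` lists (B - {c})) ((\<lambda>x. x * c) ` X) f2"
  shows "\<exists>f. labels B X f"
proof -
  define B' where "B' = B - {c}"
  define T where "T = (\<lambda>u. f1 u * c) ` lists B'"
  define Y where "Y = (\<lambda>x. x * c) ` X"
  let ?C = "act_langs X"
  let ?dec = "dec c f1 []"
  have cB': "c \<notin> B'" and BB': "B = insert c B'" using cB by (auto simp: B'_def)
  note nc = lists_notin[OF _ cB']
  have cW: "c \<in> W B" using cB by (rule W_gen)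
  have xW: "x * p \<in> X" if "x \<in> X" "p \<in> W B" for x p
    using closed that unfolding closed_act_def by blast
  have YX: "Y \<subseteq> X" using xW[OF _ cW] unfolding Y_def by blast
  have "W B' \<subseteq> W B" by (rule W_mono) (simp add: B'_def)
  then have f1W: "f1 u \<in> W B" if "u \<in> lists B'" for u
    using f1 that unfolding labels_def B'_def[symmetric] by blast
  have f1_ple: "ple (x * prod_list u) (x * f1 u)" if "u \<in> lists B'" "x \<in> X" for u x
    using f1 that unfolding labels_def B'_def[symmetric] by blast
  have f1_SF: "{u \<in> lists B'. f1 u = p} \<in> SF ?C" for p
    using f1 unfolding labels_def B'_def[symmetric] by blast
  have "T \<subseteq> W B" using W_mult[OF f1W cW] unfolding T_def by blast
  then have TW: "W T \<subseteq> W B" by (rule W_subset)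
  have f2': "labels T Y f2" using f2 unfolding T_def Y_def B'_def .
  then have f2W: "f2 w \<in> W B" if "w \<in> lists T" for w
    using that TW unfolding labels_def by blast
  have f2_ple: "ple (y * prod_list w) (y * f2 w)" if "w \<in> lists T" "y \<in> Y" for w y
    using f2' that unfolding labels_def by blast
  have f2_SF: "{w \<in> lists T. f2 w = p} \<in> SF (act_langs Y)" for p
    using f2' unfolding labels_def by blast
  have dec_T: "?dec v \<in> lists T" if "v \<in> blocks c B'" for v
    using that
  proof induction
    case (blocks_step u v)
    then have "f1 u * c \<in> T" unfolding T_def by blast
    then show ?case using blocks_step by (simp add: dec_block nc)
  qed simp
  \<comment> \<open>After each block the running element is again in \<open>Y\<close>, so the
    induction varies \<open>y\<close>.\<close>
  have dec_ple: "ple (y * prod_list v) (y * prod_list (?dec v))" if "v \<in> blocks c B'"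
    "y \<in> Y" for v y
    using that
  proof (induction arbitrary: y)
    case blocks_Nil
    then show ?case by (simp add: ple_refl)
  next
    case (blocks_step u v)
    have yX: "y \<in> X" using blocks_step.prems YX by blast
    have "ple (y * prod_list u * (c * prod_list v)) (y * f1 u * (c * prod_list v))"
      by (rule ple_mult_right[OF f1_ple[OF blocks_step(1) yX]])
    moreover have "y * f1 u * c \<in> Y" using xW[OF yX f1W[OF blocks_step(1)]] unfolding Y_def
      by blast
    then have "ple (y * f1 u * c * prod_list v) (y * f1 u * c * prod_list (?dec v))"
      by (rule blocks_step.IH)
    ultimately show ?case
      using blocks_step(1) by (simp add: dec_block nc mult.assoc) (rule ple_trans)
  qed
  have blocks_SF: "blocks c B' \<in> SF ?C"
    unfolding blocks_eq by (intro SF_union SF_conc SF_letter SF_lists SF_eps empty_act_langs)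
  \<comment> \<open>Induction on \<open>SF\<close>: a base language is handled by the common action
    of \<open>v\<close> and \<open>?dec v\<close> on first components of \<open>Y\<close>, a letter
    corresponds to a single block, and concatenation splits between blocks.\<close>
  have preimage: "{v \<in> blocks c B'. ?dec v \<in> L} \<in> SF ?C" if "L \<in> SF (act_langs Y)"
    for L
    using that
  proof induction
    case (SF_base L)
    \<comment> \<open>The words acting on \<open>Y\<close> like some word of \<open>L\<close>. As
      \<open>Y\<close> is contained in \<open>X\<close>, words acting alike on \<open>X\<close> also
      act alike on \<open>Y\<close>, so this is a base language for \<open>X\<close>.\<close>
    define L' :: "('n \<times> 'r) list set" where "L' = {w. \<exists>v\<in>L. \<forall>y\<in>Y. fst y * fst (prod_list v) = fst y * fst (prod_list w)}"
    have "L' \<in> ?C"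
    proof -
      have "(\<exists>v\<in>L. \<forall>y\<in>Y. fst y * fst (prod_list v) = fst y * fst (prod_list w)) \<longleftrightarrow>
          (\<exists>v\<in>L. \<forall>y\<in>Y. fst y * fst (prod_list v) = fst y * fst (prod_list w'))"
        if eqX: "\<forall>x\<in>X. fst x * fst (prod_list w) = fst x * fst (prod_list w')"
          for w w' :: "('n \<times> 'r) list"
      proof -
        have "fst y * fst (prod_list w) = fst y * fst (prod_list w')" if "y \<in> Y" for y
          using eqX YX that by blast
        then show ?thesis by simp
      qed
      then show ?thesis unfolding act_langs_def L'_def by simp
    qed
    moreover have "?dec v \<in> L \<longleftrightarrow> v \<in> L'" if "v \<in> blocks c B'" for v
    proof -
      have eq: "fst y * fst (prod_list v) = fst y * fst (prod_list (?dec v))" if "y \<in> Y" for y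
        using dec_ple[OF \<open>v \<in> blocks c B'\<close> that] by (simp add: ple_def)
      then show ?thesis using SF_base unfolding act_langs_def L'_def by auto
    qed
    then have "{v \<in> blocks c B'. ?dec v \<in> L} = blocks c B' \<inter> L'" by blast
    ultimately show ?case using SF_inter[OF blocks_SF SF.SF_base] by simp
  next
    case (SF_letter b)
    have "{v \<in> blocks c B'. ?dec v \<in> {[b]}} =
        (\<Union>p\<in>{p. p * c = b}. conc {u \<in> lists B'. f1 u = p} {[c]})" (is "?L = ?R")
    proof (intro equalityI subsetI)
      fix v assume "v \<in> ?L"
      then have "v \<in> blocks c B'" "?dec v = [b]" by auto
      then show "v \<in> ?R"
      proof cases
        case (blocks_step u v')
        then have b: "f1 u * c = b" "?dec v' = []" using \<open>?dec v = [b]\<close>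
          by (auto simp: dec_block nc)
        from \<open>v' \<in> blocks c B'\<close> have "v' = []"
          by cases (use b(2) in \<open>auto simp: dec_block nc\<close>)
        then show ?thesis using blocks_step b by (auto simp: conc_def)
      qed simp
    next
      fix v assume "v \<in> ?R"
      then obtain u where "u \<in> lists B'" "f1 u * c = b" "v = u @ c # []"
        unfolding conc_def by blast
      then show "v \<in> ?L"
        using blocks.blocks_step[OF _ blocks_Nil, of u B' c] dec_block[OF nc, of u f1 "[]" "[]"] by auto
    qed
    moreover have "?R \<in> SF ?C"
      by (intro SF_UN SF_conc SF.SF_letter f1_SF empty_act_langs) auto
    ultimately show ?case by simp
  next
    case (SF_union K L)
    have "{v \<in> blocks c B'. ?dec v \<in> K \<union> L} =
        {v \<in> blocks c B'. ?dec v \<in> K} \<union> {v \<in> blocks c B'. ?dec v \<in> L}" by blast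
    then show ?case using SF.SF_union[OF SF_union.IH] by simp
  next
    case (SF_compl L)
    have "{v \<in> blocks c B'. ?dec v \<in> - L} = blocks c B' \<inter> - {v \<in> blocks c B'. ?dec v \<in> L}" by blast
    then show ?case using SF_inter[OF blocks_SF SF.SF_compl[OF SF_compl.IH]] by simp
  next
    case (SF_conc K L)
    have "{v \<in> blocks c B'. ?dec v \<in> conc K L} =
        conc {v \<in> blocks c B'. ?dec v \<in> K} {v \<in> blocks c B'. ?dec v \<in> L}" (is "?L = ?R")
    proof (intro equalityI subsetI)
      fix v assume "v \<in> ?L"
      then obtain p q where "v \<in> blocks c B'" "?dec v = p @ q" "p \<in> K" "q \<in> L"
        by (auto simp: conc_def)
      moreover obtain v1 v2 where "v1 \<in> blocks c B'" "v2 \<in> blocks c B'" "v = v1 @ v2"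
        "?dec v1 = p" "?dec v2 = q"
        using blocks_split[OF calculation(1) cB' calculation(2)] by blast
      ultimately show "v \<in> ?R" unfolding conc_def by blast
    next
      fix v assume "v \<in> ?R"
      then obtain v1 v2 where v: "v = v1 @ v2" "v1 \<in> blocks c B'" "v2 \<in> blocks c B'"
        "?dec v1 \<in> K" "?dec v2 \<in> L" unfolding conc_def by blast
      then have "?dec v = ?dec v1 @ ?dec v2" using dec_append[OF _ cB'] by blast
      moreover have "v \<in> blocks c B'" unfolding v(1) by (rule blocks_append[OF v(2,3)])
      ultimately show "v \<in> ?L" using v(4,5) by (auto simp: conc_def)
    qed
    then show ?case using SF.SF_conc[OF SF_conc.IH] by simp
  qed
  \<comment> \<open>Here \<open>z\<close> is what follows the first \<open>c\<close>. Decoding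
    \<open>z\<close> ignores its final factor without \<open>c\<close>, which the reversed
    \<open>takeWhile\<close> recovers for \<open>f1\<close>.\<close>
  define f where "f w = (if c \<in> set w then
      let z = tl (dropWhile (\<lambda>a. a \<noteq> c) w) in
      f1 (takeWhile (\<lambda>a. a \<noteq> c) w) * c * f2 (?dec z) * f1 (rev (takeWhile (\<lambda>a. a \<noteq> c) (rev z)))
    else f1 w)" for w
  have f_blocks: "f (u @ c # v @ u') = f1 u * c * f2 (?dec v) * f1 u'"
    if "u \<in> lists B'" "v \<in> blocks c B'" "u' \<in> lists B'" for u v u'
  proof -
    have "takeWhile (\<lambda>a. a \<noteq> c) (u @ c # v @ u') = u"
      using nc[OF that(1)] by (subst takeWhile_append2) auto
    moreover have "dropWhile (\<lambda>a. a \<noteq> c) (u @ c # v @ u') = c # v @ u'"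
      using nc[OF that(1)] by (subst dropWhile_append2) auto
    moreover have "?dec (v @ u') = ?dec v"
      by (simp add: dec_append[OF that(2) cB'] dec_tail nc[OF that(3)])
    ultimately show ?thesis
      using last_block[OF that(2) nc[OF that(3)]] by (simp add: f_def Let_def)
  qed
  have f_free: "f u = f1 u" if "u \<in> lists B'" for u using nc[OF that] by (simp add: f_def)
  have cases: "w \<in> lists B' \<or> (\<exists>u\<in>lists B'. \<exists>v\<in>blocks c B'. \<exists>u'\<in>lists B'. w = u @ c # v @ u')"
    if "w \<in> lists B" for w
  proof (cases "c \<in> set w")
    case True
    then show ?thesis using that unfolding BB' by (intro disjI2 decompose_blocks)
  next
    case False
    then show ?thesis using that unfolding BB' by (auto simp: lists_eq_set)
  qed
  have mem: "u @ c # v @ u' \<in> lists B" if "u \<in> lists B'" "v \<in> blocks c B'"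
    "u' \<in> lists B'" for u v u'
    using that blocks_lists[OF that(2)] unfolding BB' by (auto simp: lists_eq_set)
  have "f w \<in> W B \<and> (\<forall>x\<in>X. ple (x * prod_list w) (x * f w))"
    if "w \<in> lists B" for w
    using cases[OF that]
  proof (elim disjE bexE)
    assume "w \<in> lists B'"
    then show ?thesis using f1W f1_ple f_free by simp
  next
    fix u v u' assume u: "u \<in> lists B'" and v: "v \<in> blocks c B'" and u': "u' \<in> lists B'"
      and w: "w = u @ c # v @ u'"
    have "f w \<in> W B"
      unfolding w f_blocks[OF u v u'] by (intro W_mult f1W cW f2W dec_T u v u')
    moreover have "ple (x * prod_list w) (x * f w)" if x: "x \<in> X" for x
    proof -
      let ?y = "x * f1 u * c"
      have xu: "x * f1 u \<in> X" by (rule xW[OF x f1W[OF u]])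
      then have y: "?y \<in> Y" unfolding Y_def by blast
      have z: "?y * f2 (?dec v) \<in> X" using xW[OF _ f2W[OF dec_T[OF v]]] y YX by blast
      have "ple (x * prod_list u * (c * prod_list v * prod_list u')) (x * f1 u * (c * prod_list v * prod_list u'))"
        by (rule ple_mult_right[OF f1_ple[OF u x]])
      then have 1: "ple (x * prod_list w) (?y * prod_list v * prod_list u')"
        by (simp add: w mult.assoc)
      have "ple (?y * prod_list v) (?y * f2 (?dec v))"
        by (rule ple_trans[OF dec_ple[OF v y] f2_ple[OF dec_T[OF v] y]])
      then have 2: "ple (?y * prod_list v * prod_list u') (?y * f2 (?dec v) * prod_list u')"
        by (rule ple_mult_right)
      have "ple (?y * f2 (?dec v) * prod_list u') (?y * f2 (?dec v) * f1 u')"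
        by (rule f1_ple[OF u' z])
      moreover have "?y * f2 (?dec v) * f1 u' = x * f w"
        unfolding w f_blocks[OF u v u'] by (simp add: mult.assoc)
      ultimately show ?thesis using ple_trans[OF 1 ple_trans[OF 2]] by simp
    qed
    ultimately show ?thesis by blast
  qed
  moreover have "{w \<in> lists B. f w = p} \<in> SF ?C" for p
  proof -
    let ?F = "\<lambda>q. {u \<in> lists B'. f1 u = q}"
    let ?G = "\<lambda>q. {v \<in> blocks c B'. ?dec v \<in> {w \<in> lists T. f2 w = q}}"
    \<comment> \<open>The fibre over \<open>p\<close> is the union over triples of labels whose
      product with \<open>c\<close> is \<open>p\<close>; the weights being finite, there are
      finitely many triples.\<close>
    define M where "M = (\<lambda>(q, s, q'). conc (?F q) (conc {[c]} (conc (?G s) (?F q'))))"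
    define I where "I = {(q, s, q'). q * c * s * q' = p}"
    have "{w \<in> lists B. f w = p} = ?F p \<union>
(\<Union>i\<in>I. M i)" (is "?L = ?F p \<union> ?R")
    proof (intro equalityI subsetI)
      fix w assume w: "w \<in> ?L"
      then have "w \<in> lists B" by simp
      from cases[OF this] show "w \<in> ?F p \<union> ?R"
      proof (elim disjE bexE)
        assume "w \<in> lists B'"
        then show ?thesis using w f_free by simp
      next
        fix u v u' assume u: "u \<in> lists B'" and v: "v \<in> blocks c B'" and u': "u' \<in> lists B'"
          and w': "w = u @ c # v @ u'"
        have "v \<in> ?G (f2 (?dec v))" "u \<in> ?F (f1 u)" "u' \<in> ?F (f1 u')" using u v u' dec_T
          by auto
        then have "u @ [c] @ v @ u' \<in> M (f1 u, f2 (?dec v), f1 u')"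
          unfolding M_def prod.case by (intro concI) simp_all
        then have "w \<in> M (f1 u, f2 (?dec v), f1 u')" by (simp add: w')
        moreover have "(f1 u, f2 (?dec v), f1 u') \<in> I"
          using w f_blocks[OF u v u'] w' by (simp add: I_def)
        ultimately show ?thesis by blast
      qed
    next
      fix w assume "w \<in> ?F p \<union> ?R"
      then consider "w \<in> ?F p" | "w \<in> ?R" by blast
      then show "w \<in> ?L"
      proof cases
        case 1
        then show ?thesis using f_free BB' by auto
      next
        case 2
        then obtain q s q' where "(q, s, q') \<in> I" and w: "w \<in> M (q, s, q')" by auto
        then have i: "q * c * s * q' = p" by (simp add: I_def)
        from w obtain u v u' where "u \<in> ?F q" "v \<in> ?G s" "u' \<in> ?F q'"
          "w = u @ [c] @ v @ u'"
          unfolding M_def prod.case by (elim concE) simp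
        then show ?thesis using i f_blocks[of u v u'] mem[of u v u'] by simp
      qed
    qed
    moreover have "?R \<in> SF ?C"
    proof (rule SF_UN[OF empty_act_langs])
      fix i assume "i \<in> I"
      obtain q s q' where "i = (q, s, q')" by (cases i)
      then show "M i \<in> SF ?C"
        by (simp only: M_def prod.case) (intro SF_conc SF_letter f1_SF preimage f2_SF)
    qed simp
    ultimately show ?thesis using SF_union[OF f1_SF] by simp
  qed
  ultimately have "labels B X f" unfolding labels_def by blast
  then show ?thesis by blast
qed

text \<open>Lexicographic induction: removing \<open>c\<close> keeps \<open>X\<close> and shrinks
  the alphabet, while the decoded alphabet \<open>T\<close> may be large but acts on a smaller
  set.\<close>

lemma labels_exist:
  fixes B X :: "('n::{monoid_mult,finite} \<times> 'r) set"
  assumes "closed_act B X" "detects_aperiodic B X"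
  shows "\<exists>f. labels B X f"
  using assms
proof (induction "(card X, card B)" arbitrary: B X rule: wf_induct_rule[OF wf_lex_prod[OF wf_less_than wf_less_than]])
  case (1 B X)
  note closed = 1(2) and det = 1(3)
  show ?case
  proof (cases "\<forall>b\<in>B. (\<lambda>x. x * b) ` X = X")
    case True
    then show ?thesis using labels_permutation[OF closed det] by blast
  next
    case False
    then obtain c where c: "c \<in> B" "(\<lambda>x. x * c) ` X \<noteq> X" by blast
    have cW: "c \<in> W B" using c(1) by (rule W_gen)
    define Y where "Y = (\<lambda>x. x * c) ` X"
    have xW: "x * p \<in> X" if "x \<in> X" "p \<in> W B" for x p
      using closed that unfolding closed_act_def by blast
    have "Y \<subset> X" using xW[OF _ cW] c(2) unfolding Y_def by blast
    then have Y: "card Y < card X" by (simp add: psubset_card_mono)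
    have sub: "W (B - {c}) \<subseteq> W B" by (rule W_mono) blast
    have "card (B - {c}) < card B" using c(1) by (intro card_Diff1_less) auto
    moreover have "closed_act (B - {c}) X" using closed sub unfolding closed_act_def by blast
    moreover have "detects_aperiodic (B - {c}) X"
      using det sub unfolding detects_aperiodic_def by (meson subsetD)
    ultimately obtain f1 where f1: "labels (B - {c}) X f1"
      using 1(1)[of X "B - {c}"] by auto
    define T where "T = (\<lambda>u. f1 u * c) ` lists (B - {c})"
    have "f1 u \<in> W B" if "u \<in> lists (B - {c})" for u using f1 sub that unfolding labels_def
      by blast
    then have "T \<subseteq> (\<lambda>p. p * c) ` W B" unfolding T_def by blast
    then have TW: "W T \<subseteq> insert 1 ((\<lambda>p. p * c) ` W B)" by (rule W_local[OF cW])
    have "closed_act T Y"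
      unfolding closed_act_def
    proof (intro ballI)
      fix y p assume y: "y \<in> Y" and "p \<in> W T"
      then consider "p = 1" | p' where "p = p' * c" "p' \<in> W B" using TW by blast
      then show "y * p \<in> Y"
      proof cases
        case 2
        have "y \<in> X" using y \<open>Y \<subset> X\<close> by blast
        then have "y * p' * c \<in> Y" using xW[OF _ 2(2)] unfolding Y_def by blast
        then show ?thesis using 2 by (simp add: mult.assoc)
      qed (use y in simp)
    qed
    moreover have "detects_aperiodic T Y"
      unfolding detects_aperiodic_def
    proof (intro ballI impI)
      fix p assume "p \<in> W T" and "\<exists>k. \<forall>x\<in>Y. fst x * fst p ^ Suc k = fst x * fst p ^ k"
      then obtain k where k: "\<And>y. y \<in> Y \<Longrightarrow> fst y * fst p ^ Suc k = fst y * fst p ^ k" by blast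
      from \<open>p \<in> W T\<close> consider "p = 1" | p' where "p = p' * c" "p' \<in> W B"
        using TW by blast
      then show "\<exists>k. fst p ^ Suc k = fst p ^ k"
      proof cases
        case 2
        \<comment> \<open>One factor \<open>p\<close> ends in \<open>c\<close> and so moves
          \<open>x\<close> into \<open>Y\<close>; stabilization at \<open>k\<close> on
          \<open>Y\<close> gives stabilization at \<open>Suc k\<close> on \<open>X\<close>.\<close>
        have "fst x * fst p ^ Suc (Suc k) = fst x * fst p ^ Suc k" if "x \<in> X" for x
        proof -
          have "x * p \<in> Y" using xW[OF that 2(2)] unfolding Y_def 2(1)
            by (metis image_eqI mult.assoc)
          from k[OF this] show ?thesis by (simp add: mult.assoc)
        qed
        moreover have "p \<in> W B" using 2 cW by (simp add: W_mult)
        ultimately show ?thesis using det unfolding detects_aperiodic_def by blast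
      qed simp
    qed
    ultimately obtain f2 where "labels T Y f2" using 1(1)[of Y T] Y by auto
    then show ?thesis using labels_step[OF closed c(1) f1] unfolding T_def Y_def by blast
  qed
qed

text \<open>On the full set of weights aperiodicity is detected by testing at
  \<open>x = 1\<close>.\<close>

lemma labels_UNIV: "\<exists>f. labels B UNIV f"
proof (rule labels_exist)
  show "closed_act B UNIV" by (simp add: closed_act_def)
  show "detects_aperiodic B UNIV"
    unfolding detects_aperiodic_def by (metis UNIV_I fst_one_prod mult_1)
qed

end

section \<open>The least saturated set\<close>

text \<open>Reading letters as weights, the fibres of a labelling pull back to an
  \<open>SF C\<close>-cover whose ratings are bounded by the labels, and all labels lie in the
  saturated set.\<close>

lemma opt_imprint_subset_saturated:
  fixes C :: "'a::finite list set set"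
    and \<eta> :: "'a list \<Rightarrow> 'n::{monoid_mult,finite}"
    and \<rho> :: "'a list set \<Rightarrow> 'r::{semiring_0,monoid_mult,finite}"
  assumes C: "prevariety C"
    and \<eta>: "canonical_C_morphism C \<eta>"
    and \<rho>: "multiplicative_rating_map \<rho>" "nice \<rho>"
    and \<omega>: "\<omega> > 0" "\<forall>r::'r. r ^ \<omega> * r ^ \<omega> = r ^ \<omega>"
    and S: "SF_saturated \<eta> \<rho> \<omega> S"
  shows "{(t, r). r \<in> opt_imprint (SF C) (\<eta> -` {t}) \<rho>} \<subseteq> S"
proof -
  have emp: "{} \<in> C" using C by (auto simp: prevariety_def lattice_def)
  have pre: "\<eta> -` F \<in> C" and \<eta>_Nil: "\<eta> [] = 1" and \<eta>_app: "\<eta> (u @ v) = \<eta> u * \<eta> v" for F u v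
    using \<eta> by (auto simp: canonical_C_morphism_def C_morphism_def monoid_morphism_def)
  have rat: "rating_map \<rho>" and idem: "r + r = r" and \<rho>0: "\<rho> {} = 0" and \<rho>1: "\<rho> {[]} = 1"
    and \<rho>_conc: "\<rho> (conc K L) = \<rho> K * \<rho> L" and \<rho>_Un: "\<rho> (K \<union> L) = \<rho> K + \<rho> L" for K L and r :: 'r
    using \<rho>(1) by (auto simp: multiplicative_rating_map_def rating_map_def)
  interpret idempotent_power \<omega> "TYPE('r)"
    by unfold_locales (use idem \<omega> in blast)+
  define h where "h a = (\<eta> [a], \<rho> {[a]})" for a
  define B where "B = range h"
  have S1: "(\<eta> w, \<rho> {w}) \<in> S" and S2: "(t, r) \<in> S \<Longrightarrow> rle q r \<Longrightarrow> (t, q) \<in> S"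
    and S3: "(s, q) \<in> S \<Longrightarrow> (t, r) \<in> S \<Longrightarrow> (s * t, q * r) \<in> S"
    and S4: "(e, r) \<in> S \<Longrightarrow> e * e = e \<Longrightarrow> (e, r ^ \<omega> + r ^ Suc \<omega>) \<in> S" for w s t r q e
    using S unfolding SF_saturated_def by (blast, blast, blast, metis Suc_eq_plus1)
  have WS: "p \<in> S" if "p \<in> W B" for p
    using that
  proof induction
    case W_one
    then show ?case using S1[of "[]"] by (simp add: \<eta>_Nil \<rho>1 one_prod_def)
  next
    case (W_gen b)
    then show ?case using S1 by (auto simp: B_def h_def)
  next
    case (W_mult p q)
    then show ?case using S3[of "fst p" "snd p" "fst q" "snd q"] by (simp add: times_prod_def)
  next
    case (W_idem p)
    then show ?case using S4[of "fst p" "snd p"] by simp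
  qed
  have prod_h: "prod_list (map h w) = (\<eta> w, \<rho> {w})" for w
  proof (induction w)
    case Nil
    then show ?case by (simp add: \<eta>_Nil \<rho>1 one_prod_def)
  next
    case (Cons a w)
    have "conc {[a]} {w} = {a # w}" by (auto simp: conc_def)
    then show ?case using Cons \<eta>_app[of "[a]" w] \<rho>_conc[of "{[a]}" "{w}"]
      by (simp add: h_def times_prod_def)
  qed
  obtain f where "labels B UNIV f" using labels_UNIV by blast
  then have fW: "f w \<in> W B" and f_ple: "ple (x * prod_list w) (x * f w)"
    and f_SF: "{w \<in> lists B. f w = p} \<in> SF (act_langs UNIV)" if "w \<in> lists B" for w x p
    using that unfolding labels_def by blast+
  have hB: "map h w \<in> lists B" for w by (auto simp: B_def lists_eq_set)
  \<comment> \<open>A base language sees a weight word only through the first component of its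
    product, which is \<open>\<eta> w\<close>; it therefore pulls back to a language recognized by
    \<open>\<eta>\<close>.\<close>
  have preimage: "map h -` L \<in> SF C" if "L \<in> SF (act_langs UNIV)" for L
    using that
  proof induction
    case (SF_base L)
    have same: "map h w \<in> L \<longleftrightarrow> map h w' \<in> L" if "\<eta> w = \<eta> w'"
      for w w'
      using SF_base that unfolding act_langs_def by (auto simp: prod_h)
    have "map h -` L = \<eta> -` (\<eta> ` (map h -` L))" using same by blast
    then show ?case using SF.SF_base[OF pre] by metis
  next
    case (SF_letter b)
    have "map h -` {[b]} = (\<Union>a\<in>{a. h a = b}. {[a]})" by (auto simp: map_eq_Cons_conv)
    moreover have "\<dots> \<in> SF C" by (intro SF_UN emp SF.SF_letter) auto
    ultimately show ?case by simp
  next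
    case (SF_union K L)
    then show ?case by (simp add: SF.SF_union)
  next
    case (SF_compl L)
    then show ?case by (simp add: SF.SF_compl vimage_Compl)
  next
    case (SF_conc K L)
    have "map h -` conc K L = conc (map h -` K) (map h -` L)"
      unfolding conc_def vimage_def by (auto simp: map_eq_append_conv)
    then show ?case using SF_conc SF.SF_conc by metis
  qed
  define K where "K p = map h -` {w \<in> lists B. f w = p}" for p
  have K_iff: "w \<in> K p \<longleftrightarrow> f (map h w) = p" for w p using hB
    by (simp add: K_def)
  have K_ple: "\<eta> w = fst p \<and> rle (\<rho> {w}) (snd p)" if "w \<in> K p" for w p
    using f_ple[OF hB[of w], of 1] that by (simp add: K_iff prod_h ple_def)
  have K_SF: "K p \<in> SF C" for p unfolding K_def by (rule preimage[OF f_SF[OF hB[of "[]"]]])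
  \<comment> \<open>Domination is known word by word; niceness reduces the rating of
    \<open>K p\<close> to that of a finite subset, a finite sum of ratings of words.\<close>
  have rK: "rle (\<rho> (K p)) (snd p)" for p
  proof -
    obtain F where F: "finite F" "F \<subseteq> K p" "\<rho> (K p) = \<rho> F" using \<rho>(2)
      unfolding nice_def by blast
    from F(1,2) have "rle (\<rho> F) (snd p)"
    proof induction
      case empty
      then show ?case by (simp add: \<rho>0 rle_def)
    next
      case (insert w F)
      then show ?case using rle_add[of "\<rho> {w}" "snd p" "\<rho> F"] K_ple \<rho>_Un[of "{w}" F]
        by simp
    qed
    then show ?thesis using F(3) by simp
  qed
  show ?thesis
  proof (intro subsetI, clarify)
    fix t r assume r: "r \<in> opt_imprint (SF C) (\<eta> -` {t}) \<rho>"
    \<comment> \<open>A word in the fibre of \<open>t\<close> has a label with first component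
      \<open>t\<close>, so these labels suffice to cover it.\<close>
    let ?KK = "K ` (W B \<inter> {p. fst p = t})"
    have "is_D_cover (SF C) (\<eta> -` {t}) ?KK"
      unfolding is_D_cover_def is_cover_def
    proof (intro conjI subsetI)
      fix w assume "w \<in> \<eta> -` {t}"
      moreover have "w \<in> K (f (map h w))" by (simp add: K_iff)
      ultimately show "w \<in> \<Union>?KK" using K_ple fW[OF hB] by fastforce
    qed (use K_SF in auto)
    moreover have "r \<in> opt_imprint (SF C) (\<eta> -` {t}) \<rho> \<longleftrightarrow>
        (\<forall>KK. is_D_cover (SF C) (\<eta> -` {t}) KK \<longrightarrow> r \<in> imprint \<rho> KK)"
      by (rule opt_imprint_iff; use SF_UNIV[OF emp] SF_inter rat in blast)
    ultimately obtain p where p: "p \<in> W B" "fst p = t" "rle r (\<rho> (K p))"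
      using r unfolding imprint_def by blast
    then show "(t, r) \<in> S"
      using S2[of t "snd p"] WS[OF p(1)] rle_trans[OF p(3) rK] by (metis prod.collapse)
  qed
qed

theorem theorem9p3:
  fixes C :: "'a::finite list set set"
    and \<eta> :: "'a list \<Rightarrow> 'n::{monoid_mult,finite}"
    and \<rho> :: "'a list set \<Rightarrow> 'r::{semiring_0,monoid_mult,finite}"
    and \<omega> :: nat
  assumes "prevariety C" and "finite C"
    and "canonical_C_morphism C \<eta>"
    and "multiplicative_rating_map \<rho>" and "nice \<rho>"
    and "\<omega> > 0" and "\<forall>r::'r. r ^ \<omega> * r ^ \<omega> = r ^ \<omega>"
  shows "least_SF_saturated \<eta> \<rho> \<omega> {(t, r). r \<in> opt_imprint (SF C) (\<eta> -` {t}) \<rho>}"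
  unfolding least_SF_saturated_def
  using saturated_opt_imprint[OF assms(1-4,6,7)]
    opt_imprint_subset_saturated[OF assms(1,3-7)] by blast

end
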